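(* Let $\mathbf{f}\in C_c^\infty(S^1;\mathbb{D})$ be a vector field. Then $\mathbf{f}$ can be recovered from either of the following two combinations of data: (a) $\mathcal{L}\mathbf{f}$ and $\mathcal{L}^1\mathbf{f}$; (b) $\mathcal{T}\mathbf{f}$ and $\mathcal{T}^1\mathbf{f}$. That is, each combination uniquely determines $\mathbf{f}$: for $\mathbf{f},\mathbf{h}\in C_c^\infty(S^1;\mathbb{D})$, (a) if $\mathcal{L}\mathbf{f}(s,\theta)=\mathcal{L}\mathbf{h}(s,\theta)$ and $\mathcal{L}^1\mathbf{f}(s,\theta)=\mathcal{L}^1\mathbf{h}(s,\theta)$ for all $s\in\mathbb{R}$, $\theta\in[0,2\pi)$, then $\mathbf{f}=\mathbf{h}$; and (b) if $\mathcal{T}\mathbf{f}(s,\theta)=\mathcal{T}\mathbf{h}(s,\theta)$ and $\mathcal{T}^1\mathbf{f}(s,\theta)=\mathcal{T}^1\mathbf{h}(s,\theta)$ for all $s\in\mathbb{R}$, $\theta\in[0,2\pi)$, then $\mathbf{f}=\mathbf{h}$.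
   Context: Let $\mathbb{D}\subseteq\mathbb{R}^2$ be the (open) unit disk. $C_c^\infty(S^1;\mathbb{D})$ denotes the space of vector fields $\mathbf{f}=(f_1,f_2)$ whose components are smooth compactly supported functions on $\mathbb{D}$, extended by zero to $\mathbb{R}^2$. Fix constants $w_0>0$ and $\lambda>0$, and put $z_R=\pi w_0^2/\lambda$ and $w(u)=w_0\sqrt{1+(u/z_R)^2}$ for $u\in\mathbb{R}$. The Gaussian beam kernel is $$K(x_1,x_2)=\frac{w_0}{w(x_2)}\exp\left(-\frac{x_1^2}{w^2(x_2)}\right).$$ For an angle $\theta\in[0,2\pi)$ write $\boldsymbol{\theta}=(\cos\theta,\sin\theta)$ and $\boldsymbol{\theta}^\perp=(-\sin\theta,\cos\theta)$. For an integer $k\ge 0$, $s\in\mathbb{R}$ and $\theta\in[0,2\pi)$ define the $k$-th moment longitudinal and transverse Gaussian beam Radon transforms $$\mathcal{L}^k\mathbf{f}(s,\theta)=\int_{\mathbb{R}^2}(\boldsymbol{\theta}^\perp\cdot\mathbf{x})^k\,K(s-\boldsymbol{\theta}\cdot\mathbf{x},\,\boldsymbol{\theta}^\perp\cdot\mathbf{x})\,\boldsymbol{\theta}^\perp\cdot\mathbf{f}(\mathbf{x})\,d\mathbf{x},$$ $$\mathcal{T}^k\mathbf{f}(s,\theta)=\int_{\mathbb{R}^2}(\boldsymbol{\theta}^\perp\cdot\mathbf{x})^k\,K(s-\boldsymbol{\theta}\cdot\mathbf{x},\,\boldsymbol{\theta}^\perp\cdot\mathbf{x})\,\boldsymbol{\theta}\cdot\mathbf{f}(\mathbf{x})\,d\mathbf{x},$$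 and write $\mathcal{L}=\mathcal{L}^0$, $\mathcal{T}=\mathcal{T}^0$. *)

theory Defs
  imports "HOL-Analysis.Analysis"
begin

definition partial_deriv :: "'n \<Rightarrow> (real^'n \<Rightarrow> real) \<Rightarrow> real^'n \<Rightarrow> real"
  where "partial_deriv i g x = frechet_derivative g (at x) (axis i 1)"

text \<open>For open \<open>S\<close>, \<open>Ck_on k S g\<close> says that \<open>g\<close> is of class \<open>C\<^sup>k\<close> on \<open>S\<close>: requiring
  total differentiability at each step loses nothing, because functions with continuous first
  partial derivatives on an open set are differentiable there.\<close>

primrec Ck_on :: "nat \<Rightarrow> (real^'n) set \<Rightarrow> (real^'n \<Rightarrow> real) \<Rightarrow> bool"
  where
    "Ck_on 0 S g \<longleftrightarrow> continuous_on S g"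
  | "Ck_on (Suc k) S g \<longleftrightarrow>
       (\<forall>x\<in>S. g differentiable (at x)) \<and> (\<forall>i. Ck_on k S (partial_deriv i g))"

definition smooth_on :: "(real^'n) set \<Rightarrow> (real^'n \<Rightarrow> real) \<Rightarrow> bool"
  where "smooth_on S g \<longleftrightarrow> (\<forall>k. Ck_on k S g)"

definition unit_disk :: "(real^2) set"
  where "unit_disk = ball 0 1"

text \<open>Smooth functions with compact support in \<open>S\<close>, extended by zero: the closure is taken in
  the whole space, so containment of the support in \<open>S\<close> forces \<open>g\<close> to vanish outside \<open>S\<close>.\<close>

definition test_functions :: "(real^'n) set \<Rightarrow> (real^'n \<Rightarrow> real) set"
  where "test_functions S =
    {g. smooth_on S g \<and> compact (closure {x. g x \<noteq> 0}) \<and> closure {x. g x \<noteq> 0} \<subseteq> S}"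

definition test_fields :: "(real^'n) set \<Rightarrow> (real^'n \<Rightarrow> real^'n) set"
  where "test_fields S = {f. \<forall>i. (\<lambda>x. f x $ i) \<in> test_functions S}"

definition rayleigh_range :: "real \<Rightarrow> real \<Rightarrow> real"
  where "rayleigh_range w0 lam = pi * w0\<^sup>2 / lam"

definition beam_width :: "real \<Rightarrow> real \<Rightarrow> real \<Rightarrow> real"
  where "beam_width w0 lam u = w0 * sqrt (1 + (u / rayleigh_range w0 lam)\<^sup>2)"

definition beam_kernel :: "real \<Rightarrow> real \<Rightarrow> real \<Rightarrow> real \<Rightarrow> real"
  where "beam_kernel w0 lam x1 x2 =
    w0 / beam_width w0 lam x2 * exp (- (x1\<^sup>2 / (beam_width w0 lam x2)\<^sup>2))"

definition dir :: "real \<Rightarrow> real^2"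
  where "dir \<theta> = vector [cos \<theta>, sin \<theta>]"

definition dir_perp :: "real \<Rightarrow> real^2"
  where "dir_perp \<theta> = vector [- sin \<theta>, cos \<theta>]"

definition longitudinal_transform ::
    "real \<Rightarrow> real \<Rightarrow> nat \<Rightarrow> (real^2 \<Rightarrow> real^2) \<Rightarrow> real \<Rightarrow> real \<Rightarrow> real"
  where "longitudinal_transform w0 lam k f s \<theta> =
    (LINT x|lborel. (dir_perp \<theta> \<bullet> x) ^ k
       * beam_kernel w0 lam (s - dir \<theta> \<bullet> x) (dir_perp \<theta> \<bullet> x) * (dir_perp \<theta> \<bullet> f x))"

definition transverse_transform ::
    "real \<Rightarrow> real \<Rightarrow> nat \<Rightarrow> (real^2 \<Rightarrow> real^2) \<Rightarrow> real \<Rightarrow> real \<Rightarrow> real"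
  where "transverse_transform w0 lam k f s \<theta> =
    (LINT x|lborel. (dir_perp \<theta> \<bullet> x) ^ k
       * beam_kernel w0 lam (s - dir \<theta> \<bullet> x) (dir_perp \<theta> \<bullet> x) * (dir \<theta> \<bullet> f x))"

end

theory Submission
  imports Defs "HOL-Probability.Distributions" "HOL-Complex_Analysis.Cauchy_Integral_Formula"
begin

text \<open>
  By linearity it suffices that a field \<open>g\<close> with vanishing data is zero.  The transverse
  transforms of a field are the longitudinal transforms of the field turned pointwise by a right
  angle, so only the longitudinal case needs work.  The argument is carried out for
  continuous fields \<open>g\<close> that vanish outside the disk.

  Write \<open>p\<close> and \<open>q\<close> for the components of \<open>x\<close> along \<open>dir \<theta>\<close> and \<open>dir_perp \<theta>\<close>.  In its first
  argument the kernel is a Gaussian whose squared width is affine in \<open>q\<^sup>2\<close>, so the two-sided Laplace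
  transform in \<open>s\<close> turns the data into
  \<open>\<integral> q\<^sup>k exp (\<tau> p + b \<tau>\<^sup>2 q\<^sup>2) (dir_perp \<theta> \<bullet> g) dx = 0\<close> for all real \<open>\<tau>\<close> (\<open>beam_data_laplace\<close>).
  Identify the plane with the complex numbers, \<open>z\<close> for the point \<open>x\<close> and \<open>G\<close> for the field \<open>g\<close>.  With
  \<open>u = z exp (- i \<theta>) = p + i q\<close> and \<open>v = cnj u\<close> the exponential at \<open>\<tau> = 1\<close> is
  \<open>exp ((u + v) / 2 - \<beta> (u - v)\<^sup>2)\<close> with \<open>\<beta> = b / 4\<close>; let \<open>P a c\<close> be its coefficient of
  \<open>u ^ a * v ^ c\<close>.  Comparing powers of \<open>\<tau>\<close>, and then Fourier coefficients in \<open>\<theta>\<close>, the case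
  \<open>k = 0\<close> relates the moments of \<open>G\<close> and of its conjugate by
  \<open>P a c * A = P (a + 1) (c - 1) * B\<close>, where \<open>A\<close> is the integral of \<open>z ^ a * cnj z ^ c * G\<close> and
  \<open>B\<close> that of \<open>z ^ (a + 1) * cnj z ^ (c - 1) * cnj G\<close> (\<open>moment_relation\<close>).  The case
  \<open>k = 1\<close> gives the same relation with \<open>P\<close> replaced by \<open>Q a c = P (a - 1) c - P a (c - 1)\<close>.
  Hence \<open>A = 0\<close> as soon as the determinant of this two by two system is nonzero.

  The determinant may vanish for special \<open>\<beta>\<close>, but on each diagonal \<open>a - c = m\<close> only finitely
  often (\<open>eventually_beam_det_nonzero\<close>).  Up to a positive factor it is a quadratic form in
  \<open>X = P a c\<close>, \<open>Y = P (a - 1) c\<close>, \<open>Z = P a (c - 1)\<close>, namely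
  \<open>2 c X\<^sup>2 - X Z + 4 \<beta> Z (Z - Y)\<close>.  As long as \<open>Y + Z\<close> stays comparable to \<open>X\<close> and \<open>(Y - Z) / c\<close>,
  the form is \<open>2 c X\<^sup>2 + 2 \<beta> (Y - Z)\<^sup>2\<close> up to lower order terms, thus positive for large
  \<open>c\<close>.  This comparability, the predicate \<open>dominant\<close>, holds on the main diagonal, where \<open>Y = Z\<close>
  and a first order recursion bounds \<open>Y / X\<close>, and it passes from one diagonal to the next.

  So on every diagonal all but finitely many moments vanish.  Multiplying the integrand by
  \<open>(1 - (1 - \<bar>z\<bar>\<^sup>2) ^ k) ^ J\<close>, a polynomial divisible by \<open>\<bar>z\<bar> ^ (2 * J)\<close> that tends to one on the
  punctured disk, recovers the missing ones (\<open>moment_eq_0_if_eventually\<close>), and the Weierstrass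
  approximation theorem gives \<open>G = 0\<close>.
\<close>

section \<open>The generating function of the beam polynomials\<close>

text \<open>
  The part of degree \<open>n\<close> of \<open>E u v = exp ((u + v) / 2 - \<beta> (u - v)\<^sup>2)\<close>, dehomogenized by
  \<open>v = 1\<close>.  The recursion is Euler's identity \<open>u E\<^sub>u + v E\<^sub>v = ((u + v) / 2 - 2 \<beta> (u - v)\<^sup>2) E\<close>
  read degree by degree.
\<close>

fun beam_poly :: "real \<Rightarrow> nat \<Rightarrow> real poly" where
  "beam_poly \<beta> 0 = 1"
| "beam_poly \<beta> (Suc 0) = [:1/2, 1/2:]"
| "beam_poly \<beta> (Suc (Suc n)) = smult (1 / real (n + 2))
     ([:1/2, 1/2:] * beam_poly \<beta> (Suc n) - smult (2 * \<beta>) ([:-1, 1:] * ([:-1, 1:] * beam_poly \<beta> n)))"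

lemma beam_poly_Suc_Suc:
  "smult (real (n + 2)) (beam_poly \<beta> (n + 2)) =
     [:1/2, 1/2:] * beam_poly \<beta> (n + 1) - smult (2 * \<beta>) ([:-1, 1:] * ([:-1, 1:] * beam_poly \<beta> n))"
proof -
  have "real (n + 2) * (1 / real (n + 2)) = 1" by simp
  then show ?thesis
    by (simp only: add_2_eq_Suc' beam_poly.simps smult_smult smult_1_left) simp
qed

declare beam_poly.simps(3) [simp del]

lemma degree_beam_poly: "degree (beam_poly \<beta> n) \<le> n"
proof (induction n rule: less_induct)
  case (less n)
  consider "n = 0" | "n = 1" | m where "n = m + 2"
    by (metis One_nat_def add_2_eq_Suc' not0_implies_Suc)
  then show ?case
  proof cases
    case 3
    have 1: "degree (beam_poly \<beta> (m+1)) \<le> m + 1" "degree (beam_poly \<beta> m) \<le> m"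
      using less 3 by auto
    have "degree ([:1/2, 1/2:] * beam_poly \<beta> (m + 1)) \<le> m + 2"
      using degree_mult_le[of "[:1/2, 1/2:]" "beam_poly \<beta> (m + 1)"] 1
      by (simp del: mult_pCons_left)
    moreover have "degree ([:-1, 1:] * ([:-1, 1:] * beam_poly \<beta> m)) \<le> m + 2"
      using degree_mult_le[of "[:-1, 1:]" "[:-1, 1:] * beam_poly \<beta> m"]
        degree_mult_le[of "[:-1, 1:]" "beam_poly \<beta> m"] 1
      by (simp del: mult_pCons_left)
    ultimately have "degree ([:1/2, 1/2:] * beam_poly \<beta> (m + 1) -
        smult (2 * \<beta>) ([:-1, 1:] * ([:-1, 1:] * beam_poly \<beta> m))) \<le> m + 2"
      by (intro degree_diff_le) (auto intro: order_trans[OF degree_smult_le] simp del: mult_pCons_left)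
    then have "degree (smult (real (m + 2)) (beam_poly \<beta> (m + 2))) \<le> m + 2"
      by (simp only: beam_poly_Suc_Suc)
    then show ?thesis
      by (simp add: 3 del: of_nat_add)
  qed auto
qed

text \<open>
  The degree \<open>n + 1\<close> part of \<open>E\<^sub>u = (1 / 2 - 2 \<beta> (u - v)) E\<close>.  The inductive step differentiates
  Euler's recursion and eliminates both derivatives by the induction hypothesis.
\<close>

lemma pderiv_beam_poly:
  "pderiv (beam_poly \<beta> (n + 2)) =
     smult (1/2) (beam_poly \<beta> (n + 1)) - smult (2 * \<beta>) ([:-1, 1:] * beam_poly \<beta> n)"
proof (induction n rule: less_induct)
  case (less n)
  consider "n = 0" | "n = 1" | m where "n = m + 2"
    by (metis One_nat_def add_2_eq_Suc' not0_implies_Suc)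
  then show ?case
  proof cases
    case 1
    then show ?thesis
      by (simp add: beam_poly.simps numeral_2_eq_2 pderiv_pCons pderiv_smult pderiv_diff algebra_simps)
  next
    case 2
    then show ?thesis
      by (simp add: beam_poly.simps numeral_2_eq_2 numeral_3_eq_3 pderiv_pCons pderiv_smult pderiv_diff algebra_simps)
  next
    case 3
    define P where "P i = beam_poly \<beta> (m + i)" for i
    define k where "k = real m"
    define U V :: "real poly" where "U = [:1/2, 1/2:]" and "V = [:-1, 1:]"
    have dU: "pderiv U = [:1/2:]" and dV: "pderiv V = 1"
      by (auto simp: U_def V_def pderiv_pCons)
    have r2: "smult (k + 2) (P 2) = U * P 1 - smult (2*\<beta>) (V * (V * P 0))"
      using beam_poly_Suc_Suc[of m \<beta>] by (simp del: mult_pCons_left add: P_def k_def U_def V_def add_ac numeral_eq_Suc)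
    have r3: "smult (k + 3) (P 3) = U * P 2 - smult (2*\<beta>) (V * (V * P 1))"
      using beam_poly_Suc_Suc[of "m+1" \<beta>] by (simp del: mult_pCons_left add: P_def k_def U_def V_def add_ac numeral_eq_Suc)
    have r4: "smult (k + 4) (P 4) = U * P 3 - smult (2*\<beta>) (V * (V * P 2))"
      using beam_poly_Suc_Suc[of "m+2" \<beta>] by (simp del: mult_pCons_left add: P_def k_def U_def V_def add_ac numeral_eq_Suc)
    have d2: "pderiv (P 2) = smult (1/2) (P 1) - smult (2*\<beta>) (V * P 0)"
      using less[of m] 3 by (simp del: mult_pCons_left add: P_def V_def numeral_eq_Suc)
    have d3: "pderiv (P 3) = smult (1/2) (P 2) - smult (2*\<beta>) (V * P 1)"
      using less[of "m+1"] 3 by (simp del: mult_pCons_left add: P_def V_def add_ac numeral_eq_Suc)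
    have e2: "(k + 2) * poly (P 2) x = poly U x * poly (P 1) x - 2*\<beta> * (poly V x * (poly V x * poly (P 0) x))"
      for x using arg_cong[OF r2, of "\<lambda>p. poly p x"] by simp
    have e3: "(k + 3) * poly (P 3) x = poly U x * poly (P 2) x - 2*\<beta> * (poly V x * (poly V x * poly (P 1) x))"
      for x using arg_cong[OF r3, of "\<lambda>p. poly p x"] by simp
    have d4: "(k + 4) * poly (pderiv (P 4)) x = poly (P 3) x / 2 + poly U x * poly (pderiv (P 3)) x
        - 2*\<beta> * (2 * poly V x * poly (P 2) x + poly V x * (poly V x * poly (pderiv (P 2)) x))" for x
    proof -
      have "smult (k + 4) (pderiv (P 4)) = pderiv (smult (k+4) (P 4))"
        by (simp add: pderiv_smult)
      also have "\<dots> = pderiv (U * P 3 - smult (2*\<beta>) (V * (V * P 2)))"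
        by (simp add: r4)
      finally show ?thesis
        by (simp add: pderiv_diff pderiv_smult pderiv_mult dU dV algebra_simps
            poly_eq_poly_eq_iff[symmetric] fun_eq_iff)
    qed
    have "poly (pderiv (P 4)) x = poly (smult (1/2) (P 3) - smult (2*\<beta>) (V * P 2)) x" for x
    proof -
      have "(k + 4) * poly (pderiv (P 4)) x = (k + 4) * (poly (P 3) x / 2 - 2*\<beta> * (poly V x * poly (P 2) x))"
        using d4[of x] e2[of x] e3[of x] unfolding d2 d3 by (simp add: field_simps) algebra
      then show ?thesis by (simp add: k_def)
    qed
    then have "pderiv (P 4) = smult (1/2) (P 3) - smult (2*\<beta>) (V * P 2)"
      by (simp add: poly_eq_poly_eq_iff[symmetric] fun_eq_iff)
    then show ?thesis
      by (simp del: mult_pCons_left add: 3 P_def V_def add_ac numeral_eq_Suc)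
  qed
qed

section \<open>Recurrences and the determinant\<close>

text \<open>
  The coefficient of \<open>u ^ a * v ^ c\<close> in \<open>E u v\<close>.
\<close>

definition beam_coeff :: "real \<Rightarrow> nat \<Rightarrow> nat \<Rightarrow> real" where
  "beam_coeff \<beta> a c = coeff (beam_poly \<beta> (a + c)) a"

lemma coeff_linear_mult: "coeff ([:r, s:] * p) (Suc n) = r * coeff p (Suc n) + s * coeff p n"
  by simp

text \<open>
  This lemma and the next compare coefficients in \<open>E\<^sub>u = (1 / 2 - 2 \<beta> (u - v)) E\<close> and
  \<open>E\<^sub>v = (1 / 2 + 2 \<beta> (u - v)) E\<close>; the second equation is Euler's identity minus the first.
  Both move away from a point \<open>(a, c)\<close> using only the three values at \<open>(a, c)\<close>, \<open>(a - 1, c)\<close>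
  and \<open>(a, c - 1)\<close>.
\<close>

lemma beam_coeff_step_left:
  assumes "a \<ge> 1" "c \<ge> 1"
  shows "(real a + 1) * beam_coeff \<beta> (a + 1) c =
    beam_coeff \<beta> a c / 2 - 2 * \<beta> * (beam_coeff \<beta> (a - 1) c - beam_coeff \<beta> a (c - 1))"
proof -
  obtain a' c' where ac: "a = Suc a'" "c = Suc c'"
    using assms by (metis One_nat_def Suc_le_D)
  have "real (Suc (Suc a')) * coeff (beam_poly \<beta> (a' + c' + 1 + 2)) (Suc (Suc a')) =
      coeff (pderiv (beam_poly \<beta> (a' + c' + 1 + 2))) (Suc a')"
    by (simp only: coeff_pderiv)
  also have "\<dots> = coeff (beam_poly \<beta> (a' + c' + 2)) (Suc a') / 2 -
      2 * \<beta> * (coeff (beam_poly \<beta> (a' + c' + 1)) a' - coeff (beam_poly \<beta> (a' + c' + 1)) (Suc a'))"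
    unfolding pderiv_beam_poly by (simp del: mult_pCons_left add: coeff_linear_mult)
  finally show ?thesis
    by (simp add: ac beam_coeff_def add_ac)
qed

lemma beam_coeff_step_right:
  assumes "a \<ge> 1" "c \<ge> 1"
  shows "(real c + 1) * beam_coeff \<beta> a (c + 1) =
    beam_coeff \<beta> a c / 2 + 2 * \<beta> * (beam_coeff \<beta> (a - 1) c - beam_coeff \<beta> a (c - 1))"
proof -
  obtain a' c' where ac: "a = Suc a'" "c = Suc c'"
    using assms by (metis One_nat_def Suc_le_D)
  define N where "N = a' + c' + 1"
  have "real (Suc a') * coeff (beam_poly \<beta> (N + 2)) (Suc a') = coeff (pderiv (beam_poly \<beta> (N + 2))) a'"
    by (simp only: coeff_pderiv)
  then have 1: "real (Suc a') * coeff (beam_poly \<beta> (N + 2)) (Suc a') =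
      coeff (beam_poly \<beta> (N + 1)) a' / 2 - 2 * \<beta> * coeff ([:-1, 1:] * beam_poly \<beta> N) a'"
    unfolding pderiv_beam_poly by (simp del: mult_pCons_left)
  have "real (N + 2) * coeff (beam_poly \<beta> (N + 2)) (Suc a') =
      coeff (smult (real (N + 2)) (beam_poly \<beta> (N + 2))) (Suc a')"
    by simp
  also have "\<dots> = coeff (beam_poly \<beta> (N + 1)) (Suc a') / 2 + coeff (beam_poly \<beta> (N + 1)) a' / 2
     - 2 * \<beta> * (coeff ([:-1, 1:] * beam_poly \<beta> N) a' + coeff (beam_poly \<beta> N) (Suc a') - coeff (beam_poly \<beta> N) a')"
    unfolding beam_poly_Suc_Suc coeff_diff coeff_smult coeff_linear_mult by (simp add: field_simps)
  finally have "real (c' + 2) * coeff (beam_poly \<beta> (N + 2)) (Suc a') =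
     coeff (beam_poly \<beta> (N + 1)) (Suc a') / 2
     + 2 * \<beta> * (coeff (beam_poly \<beta> N) a' - coeff (beam_poly \<beta> N) (Suc a'))"
    using 1 by (simp add: N_def algebra_simps)
  then show ?thesis
    by (simp add: ac beam_coeff_def add_ac N_def)
qed

lemma beam_coeff_sum:
  assumes "a \<ge> 1" "c \<ge> 1"
  shows "(real a + 1) * beam_coeff \<beta> (a + 1) c + (real c + 1) * beam_coeff \<beta> a (c + 1) = beam_coeff \<beta> a c"
  using beam_coeff_step_left[OF assms, of \<beta>] beam_coeff_step_right[OF assms, of \<beta>] by linarith

text \<open>
  The determinant of the linear system that the two data sets impose on the moment of \<open>G\<close> of
  bidegree \<open>(a, c)\<close> and the moment of \<open>cnj G\<close> of bidegree \<open>(a + 1, c - 1)\<close>.  The first factors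
  come from \<open>E\<close>, the differences from \<open>(u - v) E\<close>, which belongs to the first moment data.
\<close>

definition beam_det :: "real \<Rightarrow> nat \<Rightarrow> nat \<Rightarrow> real" where
  "beam_det \<beta> a c =
     beam_coeff \<beta> a c * (beam_coeff \<beta> a (c - 1) - beam_coeff \<beta> (a + 1) (c - 2))
   - beam_coeff \<beta> (a + 1) (c - 1) * (beam_coeff \<beta> (a - 1) c - beam_coeff \<beta> a (c - 1))"

text \<open>
  The recurrences express every coefficient in the determinant through three neighbouring ones,
  which turns it into a quadratic form in these.  Its sign is what makes the argument work.
\<close>

lemma beam_det_eq:
  fixes \<beta> :: real
  defines "p \<equiv> beam_coeff \<beta>"
  assumes "a \<ge> 2" "c \<ge> 3"
  shows "4 * \<beta> * (real a + 1) * beam_det \<beta> a c =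
    2 * real c * (p a c)\<^sup>2 - p a c * p a (c - 1) + 4 * \<beta> * p a (c - 1) * (p a (c - 1) - p (a - 1) c)"
proof -
  define x y z r s t w where
    "x = p a c" and "y = p (a - 1) c" and "z = p a (c - 1)" and "r = p (a + 1) (c - 1)"
    and "s = p (a + 1) (c - 2)" and "t = p a (c - 2)" and "w = p (a - 1) (c - 1)"
  note defs = this p_def
  define A C where "A = real a + 1" and "C = real c"
  obtain a' where a': "a = a' + 2"
    using assms by (metis le_add_diff_inverse2)
  obtain c' where c': "c = c' + 3"
    using assms by (metis le_add_diff_inverse2)
  \<comment> \<open>the recurrences at \<open>(a, c - 1)\<close>, \<open>(a, c - 2)\<close> and \<open>(a - 1, c - 1)\<close>\<close>
  have 1: "A * r + C * x = z"
    using beam_coeff_sum[of "a' + 2" "c' + 2" \<beta>] by (simp add: defs A_def C_def a' c' add_ac eval_nat_numeral)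
  have 2: "A * s + (C - 1) * z = t"
    using beam_coeff_sum[of "a' + 2" "c' + 1" \<beta>] by (simp add: defs A_def C_def a' c' add_ac eval_nat_numeral)
  have 3: "A * r = z / 2 - 2 * \<beta> * (w - t)"
    using beam_coeff_step_left[of "a' + 2" "c' + 2" \<beta>] by (simp add: defs A_def C_def a' c' add_ac eval_nat_numeral)
  have 4: "(A - 1) * z + C * y = w"
    using beam_coeff_sum[of "a' + 1" "c' + 2" \<beta>] by (simp add: defs A_def C_def a' c' add_ac eval_nat_numeral)
  have r: "A * r = z - C * x"
    using 1 by simp
  have s: "A * s = t - (C - 1) * z"
    using 2 by simp
  have t: "2 * \<beta> * t = 2 * \<beta> * w - C * x + z / 2"
    using 3 1 by (simp add: algebra_simps)
  have "4 * \<beta> * A * (x * (z - s) - r * (y - z)) =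
      2 * x * (2 * \<beta> * A * z - 2 * \<beta> * (A * s)) - 4 * \<beta> * (y - z) * (A * r)"
    by (simp add: algebra_simps)
  also have "\<dots> = 2 * x * (2 * \<beta> * A * z - 2 * \<beta> * t + 2 * \<beta> * (C - 1) * z) - 4 * \<beta> * (y - z) * (z - C * x)"
    unfolding r s by (simp add: algebra_simps)
  also have "\<dots> = 2 * C * x\<^sup>2 - x * z + 4 * \<beta> * z * (z - y)"
    unfolding t 4[symmetric] by (simp add: algebra_simps power2_eq_square)
  finally have "4 * \<beta> * A * (x * (z - s) - r * (y - z)) = 2 * C * x\<^sup>2 - x * z + 4 * \<beta> * z * (z - y)" .
  then show ?thesis
    by (simp add: defs A_def C_def beam_det_def a' c' add_ac eval_nat_numeral)
qed

section \<open>Positivity of the determinant along diagonals\<close>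

text \<open>
  In the application \<open>x\<close>, \<open>y\<close>, \<open>z\<close> are the coefficients at \<open>(a, c)\<close>, \<open>(a - 1, c)\<close>, \<open>(a, c - 1)\<close>.
  Along a diagonal the recurrences for them have solutions in which \<open>x\<close> and \<open>y - z\<close> dominate, and
  one recessive solution with \<open>y + z\<close> of order \<open>c x\<close>.  The predicate excludes the latter.
\<close>

definition dominant :: "real \<Rightarrow> real \<Rightarrow> real \<Rightarrow> real \<Rightarrow> real \<Rightarrow> bool" where
  "dominant C c x y z \<longleftrightarrow> \<bar>y + z\<bar> \<le> C * (\<bar>x\<bar> + \<bar>y - z\<bar> / c) \<and> (x \<noteq> 0 \<or> y \<noteq> z)"

lemma dominant_swap: "dominant C c x z y \<longleftrightarrow> dominant C c x y z"
  by (auto simp: dominant_def abs_minus_commute add.commute)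

text \<open>
  With \<open>W = y + z\<close> and \<open>d = y - z\<close> the form equals
  \<open>2 j x\<^sup>2 + 2 \<beta> d\<^sup>2 - x W / 2 + x d / 2 - 2 \<beta> W d\<close>.  Since \<open>W\<close> is bounded by \<open>x\<close> and \<open>d / c\<close>, the
  last three terms contribute at most a multiple of \<open>x\<^sup>2\<close>, a multiple of \<open>x d\<close> and \<open>O (d\<^sup>2 / c)\<close>;
  the coefficient of \<open>x\<^sup>2\<close> grows with \<open>j\<close> and absorbs them.
\<close>

lemma dominant_imp_form_pos:
  assumes "\<beta> > 0" "C \<ge> 0"
  shows "\<exists>c0. \<forall>c\<ge>c0. \<forall>j\<ge>c. \<forall>x y z. dominant C c x y z \<longrightarrow>
           2 * j * x\<^sup>2 - x * z + 4 * \<beta> * z * (z - y) > 0"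
proof -
  \<comment> \<open>\<open>K\<close> bounds the total coefficient of \<open>\<bar>x\<bar> * \<bar>d\<bar>\<close> in the three indefinite terms.\<close>
  define K where "K = C / 2 + 1 / 2 + 2 * \<beta> * C"
  have K0: "K \<ge> 0" using assms by (simp add: K_def)
  define c0 where "c0 = 1 + 4 * C + K\<^sup>2 / \<beta>"
  have "2 * j * x\<^sup>2 - x * z + 4 * \<beta> * z * (z - y) > 0"
    if c: "c \<ge> c0" and j: "j \<ge> c" and dom: "dominant C c x y z" for c j x y z
  proof -
    define W d where "W = y + z" and "d = y - z"
    have c1: "c \<ge> 1" using c assms K0 by (auto simp: c0_def intro: order_trans[rotated])
    have c2: "c \<ge> 4 * C" using c assms K0 by (auto simp: c0_def intro: order_trans[rotated])
    have c3: "2 * c - C / 2 - K\<^sup>2 / (4 * \<beta>) \<ge> 1"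
    proof -
      have "0 \<le> K\<^sup>2 / \<beta>" using assms by simp
      moreover have "K\<^sup>2 / (4 * \<beta>) = (K\<^sup>2 / \<beta>) / 4" by simp
      ultimately show ?thesis using c assms unfolding c0_def by linarith
    qed
    have W: "\<bar>W\<bar> \<le> C * (\<bar>x\<bar> + \<bar>d\<bar> / c)" and nz: "x \<noteq> 0 \<or> d \<noteq> 0"
      using dom by (auto simp: dominant_def W_def d_def)
    have dc: "\<bar>d\<bar> / c \<le> \<bar>d\<bar>" using c1 by (simp add: divide_le_eq mult_le_cancel_left1)
    have W': "\<bar>W\<bar> \<le> C * \<bar>x\<bar> + C * \<bar>d\<bar>"
      using W mult_left_mono[OF dc, of C] assms by (simp add: algebra_simps)
    have 1: "x * W / 2 \<le> C / 2 * x\<^sup>2 + C / 2 * (\<bar>x\<bar> * \<bar>d\<bar>)"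
    proof -
      have "x * W \<le> \<bar>x\<bar> * \<bar>W\<bar>" by (metis abs_ge_self abs_mult)
      also have "\<dots> \<le> \<bar>x\<bar> * (C * \<bar>x\<bar> + C * \<bar>d\<bar>)" by (intro mult_left_mono W') auto
      also have "\<dots> = C * x\<^sup>2 + C * (\<bar>x\<bar> * \<bar>d\<bar>)"
        by (simp add: algebra_simps power2_eq_square)
      finally show ?thesis by simp
    qed
    have 2: "2 * \<beta> * W * d \<le> 2 * \<beta> * C * (\<bar>x\<bar> * \<bar>d\<bar>) + \<beta> / 2 * d\<^sup>2"
    proof -
      have "W * d \<le> \<bar>W\<bar> * \<bar>d\<bar>" by (metis abs_ge_self abs_mult)
      also have "\<dots> \<le> C * (\<bar>x\<bar> + \<bar>d\<bar> / c) * \<bar>d\<bar>" by (intro mult_right_mono W) auto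
      also have "\<dots> = C * (\<bar>x\<bar> * \<bar>d\<bar>) + C / c * d\<^sup>2"
        by (simp add: algebra_simps power2_eq_square)
      also have "C / c * d\<^sup>2 \<le> 1 / 4 * d\<^sup>2"
        using c1 c2 by (intro mult_right_mono) (auto simp: divide_le_eq)
      finally have "W * d \<le> C * (\<bar>x\<bar> * \<bar>d\<bar>) + 1 / 4 * d\<^sup>2" by simp
      from mult_left_mono[OF this, of "2 * \<beta>"] show ?thesis
        using assms by (simp add: algebra_simps)
    qed
    have 3: "- (x * d / 2) \<le> 1 / 2 * (\<bar>x\<bar> * \<bar>d\<bar>)"
      using abs_ge_minus_self[of "x * d"] by (simp add: abs_mult)
    have 4: "K * (\<bar>x\<bar> * \<bar>d\<bar>) \<le> \<beta> * d\<^sup>2 + K\<^sup>2 / (4 * \<beta>) * x\<^sup>2"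
    proof -
      have "0 \<le> (2 * \<beta> * \<bar>d\<bar> - K * \<bar>x\<bar>)\<^sup>2" by simp
      then have "4 * \<beta> * (K * (\<bar>x\<bar> * \<bar>d\<bar>)) \<le> 4 * \<beta>\<^sup>2 * d\<^sup>2 + K\<^sup>2 * x\<^sup>2"
        by (simp add: power2_diff power_mult_distrib algebra_simps)
      also have "\<dots> = 4 * \<beta> * (\<beta> * d\<^sup>2 + K\<^sup>2 / (4 * \<beta>) * x\<^sup>2)"
        using assms by (simp add: field_simps power2_eq_square)
      finally show ?thesis using assms by (simp only: mult_le_cancel_left_pos)
    qed
    have 5: "K * (\<bar>x\<bar> * \<bar>d\<bar>) = C / 2 * (\<bar>x\<bar> * \<bar>d\<bar>) + 1 / 2 * (\<bar>x\<bar> * \<bar>d\<bar>) + 2 * \<beta> * C * (\<bar>x\<bar> * \<bar>d\<bar>)"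
      by (simp add: K_def algebra_simps)
    have "x\<^sup>2 + \<beta> / 2 * d\<^sup>2 > 0"
      using nz assms by (cases "x = 0") (auto intro: add_pos_nonneg add_nonneg_pos)
    also have "x\<^sup>2 + \<beta> / 2 * d\<^sup>2 \<le> (2 * c - C / 2 - K\<^sup>2 / (4 * \<beta>)) * x\<^sup>2 + \<beta> / 2 * d\<^sup>2"
      using mult_right_mono[OF c3, of "x\<^sup>2"] by simp
    also have "\<dots> \<le> 2 * c * x\<^sup>2 + 2 * \<beta> * d\<^sup>2 - x * W / 2 + x * d / 2 - 2 * \<beta> * W * d"
    proof -
      have "(2 * c - C / 2 - K\<^sup>2 / (4 * \<beta>)) * x\<^sup>2 + \<beta> / 2 * d\<^sup>2 =
          2 * c * x\<^sup>2 - C / 2 * x\<^sup>2 - K\<^sup>2 / (4 * \<beta>) * x\<^sup>2 + \<beta> / 2 * d\<^sup>2"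
        by (simp add: algebra_simps)
      moreover have "\<beta> * d\<^sup>2 = 2 * (\<beta> / 2 * d\<^sup>2)" "2 * \<beta> * d\<^sup>2 = 4 * (\<beta> / 2 * d\<^sup>2)" by auto
      ultimately show ?thesis using 1 2 3 4 5 by linarith
    qed
    also have "\<dots> \<le> 2 * j * x\<^sup>2 + 2 * \<beta> * d\<^sup>2 - x * W / 2 + x * d / 2 - 2 * \<beta> * W * d"
      using mult_right_mono[OF j, of "2 * x\<^sup>2"] by (simp add: mult_ac)
    also have "\<dots> = 2 * j * x\<^sup>2 - x * z + 4 * \<beta> * z * (z - y)"
      by (simp add: W_def d_def algebra_simps power2_eq_square) (simp add: field_simps)
    finally show ?thesis .
  qed
  then show ?thesis by blast
qed

text \<open>
  The map in the conclusion sends the values at \<open>(a, c)\<close>, \<open>(a - 1, c)\<close>, \<open>(a, c - 1)\<close> to those at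
  \<open>(a + 1, c)\<close>, \<open>(a, c)\<close>, \<open>(a + 1, c - 1)\<close>.  For large \<open>a\<close> the pair formed by \<open>a + 1\<close> times the new
  \<open>x\<close> and the new \<open>y - z\<close> controls the old \<open>x\<close> and \<open>y - z\<close>, because to leading order it is an
  invertible linear function of them with coefficients bounded above and below, whereas the new
  \<open>y + z\<close> is smaller by a factor \<open>1 / a\<close> since \<open>a - c\<close> stays bounded.
\<close>

lemma dominant_step:
  assumes "\<beta> > 0" "C \<ge> 0"
  shows "\<exists>C'\<ge>0. \<exists>c0. \<forall>c\<ge>c0. \<forall>a x y z. c \<le> a \<longrightarrow> a \<le> c + k \<longrightarrow> dominant C c x y z \<longrightarrow>
           dominant C' c ((x / 2 - 2 * \<beta> * (y - z)) / (a + 1)) x ((z - c * x) / (a + 1))"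
proof -
  define m where "m = 1 + 1 / (4 * \<beta>)"
  define M where "M = 2 * m + 1 / \<beta>"
  define C' where "C' = (\<bar>k\<bar> + C + 2) * M"
  define c0 where "c0 = 1 + 2 * m * (C + 1)"
  have m0: "m > 0" and M0: "M > 0" using assms by (auto simp: m_def M_def intro!: add_pos_pos)
  have "dominant C' c ((x / 2 - 2 * \<beta> * (y - z)) / (a + 1)) x ((z - c * x) / (a + 1))"
    if c: "c \<ge> c0" and a: "c \<le> a" "a \<le> c + k" and dom: "dominant C c x y z" for c a x y z
  proof -
    define W d A where "W = y + z" and "d = y - z" and "A = a + 1"
    define S where "S = \<bar>x\<bar> + \<bar>d\<bar>"
    define X1 where "X1 = x / 2 - 2 * \<beta> * d"
    define W1 where "W1 = x + (z - c * x) / A"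
    define d1 where "d1 = x - (z - c * x) / A"
    have c1: "c \<ge> 1" using c assms m0 by (auto simp: c0_def intro: order_trans[rotated])
    have A: "A \<ge> 2 * m * (C + 1)" "A > 0" "c \<le> A" using c c1 a by (auto simp: c0_def A_def)
    have W: "\<bar>W\<bar> \<le> C * (\<bar>x\<bar> + \<bar>d\<bar> / c)" and nz: "x \<noteq> 0 \<or> d \<noteq> 0"
      using dom by (auto simp: dominant_def W_def d_def)
    have S0: "S > 0" using nz by (auto simp: S_def)
    have "\<bar>d\<bar> / c \<le> \<bar>d\<bar>" using c1 by (simp add: divide_le_eq mult_le_cancel_left1)
    then have "\<bar>W\<bar> \<le> C * S"
      using W mult_left_mono[of "\<bar>x\<bar> + \<bar>d\<bar> / c" S C] assms by (simp add: S_def)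
    moreover have "2 * \<bar>z\<bar> \<le> \<bar>W\<bar> + \<bar>d\<bar>" by (simp add: W_def d_def)
    moreover have "\<bar>d\<bar> \<le> S" by (simp add: S_def)
    ultimately have "2 * \<bar>z\<bar> \<le> C * S + S" by (meson add_mono order_trans)
    then have "\<bar>z\<bar> \<le> (C * S + S) / 2" by simp
    also have "\<dots> \<le> (C + 1) * S" using assms S0 by (simp add: algebra_simps)
    finally have z: "\<bar>z\<bar> \<le> (C + 1) * S" .
    \<comment> \<open>The new sum \<open>W1\<close> is small because \<open>A - c\<close> is bounded; the new difference \<open>d1\<close> is not.\<close>
    have W1: "\<bar>W1\<bar> \<le> (\<bar>k\<bar> + C + 2) * S / A"
    proof -
      have "W1 = ((A - c) * x + z) / A" using A by (simp add: W1_def field_simps)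
      moreover have "\<bar>(A - c) * x + z\<bar> \<le> (\<bar>k\<bar> + 1) * S + (C + 1) * S"
      proof -
        have "\<bar>(A - c) * x\<bar> \<le> (\<bar>k\<bar> + 1) * S"
          unfolding abs_mult using a by (intro mult_mono) (auto simp: A_def S_def)
        then show ?thesis using z by linarith
      qed
      ultimately show ?thesis using A by (simp add: divide_right_mono algebra_simps)
    qed
    have d1: "\<bar>x\<bar> - (C + 1) * S / A \<le> \<bar>d1\<bar>"
    proof -
      have "d1 = (1 + c / A) * x - z / A" using A by (simp add: d1_def field_simps)
      moreover have "\<bar>x\<bar> \<le> \<bar>(1 + c / A) * x\<bar>"
        using c1 A by (simp add: abs_mult mult_le_cancel_right1)
      moreover have "\<bar>z / A\<bar> \<le> (C + 1) * S / A" using z A by (simp add: divide_right_mono)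
      ultimately show ?thesis by linarith
    qed
    have d: "\<bar>d\<bar> \<le> \<bar>X1\<bar> / (2 * \<beta>) + \<bar>x\<bar> / (4 * \<beta>)"
    proof -
      have "2 * \<beta> * \<bar>d\<bar> = \<bar>x / 2 - X1\<bar>" using assms by (simp add: X1_def abs_mult)
      then have "2 * \<beta> * \<bar>d\<bar> \<le> \<bar>x\<bar> / 2 + \<bar>X1\<bar>" by linarith
      then show ?thesis using assms by (simp add: field_simps)
    qed
    \<comment> \<open>Bound \<open>S\<close> by \<open>d1\<close> and \<open>X1\<close>; the error term in \<open>S / A\<close> is at most \<open>S / 2\<close> by the choice of \<open>c0\<close>.\<close>
    have "S \<le> m * \<bar>x\<bar> + \<bar>X1\<bar> / (2 * \<beta>)"
      using d by (simp add: S_def m_def algebra_simps)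
    also have "m * \<bar>x\<bar> \<le> m * (\<bar>d1\<bar> + (C + 1) * S / A)"
      using d1 m0 by (intro mult_left_mono) auto
    also have "m * (\<bar>d1\<bar> + (C + 1) * S / A) = m * \<bar>d1\<bar> + (m * (C + 1) / A) * S"
      by (simp add: algebra_simps)
    also have "(m * (C + 1) / A) * S \<le> 1 / 2 * S"
      using A S0 by (intro mult_right_mono) (auto simp: divide_le_eq)
    finally have "S \<le> 2 * m * \<bar>d1\<bar> + \<bar>X1\<bar> / \<beta>" by (simp add: field_simps)
    also have "\<dots> \<le> M * (\<bar>d1\<bar> + \<bar>X1\<bar>)"
      using m0 assms by (simp add: M_def algebra_simps)
    finally have S: "S \<le> M * (\<bar>d1\<bar> + \<bar>X1\<bar>)" .
    have "\<bar>W1\<bar> \<le> (\<bar>k\<bar> + C + 2) * (M * (\<bar>d1\<bar> + \<bar>X1\<bar>)) / A"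
      using W1 S A assms by (elim order_trans) (intro divide_right_mono mult_left_mono, auto)
    also have "\<dots> = C' * (\<bar>X1 / A\<bar> + \<bar>d1\<bar> / A)"
      using A by (simp add: C'_def field_simps)
    also have "\<dots> \<le> C' * (\<bar>X1 / A\<bar> + \<bar>d1\<bar> / c)"
      using A c1 M0 assms by (intro mult_left_mono add_left_mono divide_left_mono) (auto simp: C'_def)
    finally have 1: "\<bar>W1\<bar> \<le> C' * (\<bar>X1 / A\<bar> + \<bar>d1\<bar> / c)" .
    have "X1 / A \<noteq> 0 \<or> d1 \<noteq> 0"
      using S S0 A by auto
    then show ?thesis
      using 1 unfolding dominant_def X1_def W1_def d1_def A_def d_def by auto
  qed
  moreover have "C' \<ge> 0" using assms M0 by (simp add: C'_def)
  ultimately show ?thesis by blast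
qed

text \<open>
  On the main diagonal the symmetry \<open>E u v = E v u\<close> forces \<open>y = z\<close>, and the recurrences reduce to
  a system for \<open>x\<close> and \<open>z\<close> alone.
\<close>

lemma beam_coeff_diagonal_Suc:
  assumes "c \<ge> 1" and sym: "beam_coeff \<beta> (c - 1) c = beam_coeff \<beta> c (c - 1)"
  shows "(real c + 1) * beam_coeff \<beta> (Suc c) c = beam_coeff \<beta> c c / 2"
    and "(real c + 1) * beam_coeff \<beta> c (Suc c) = beam_coeff \<beta> c c / 2"
    and "(real c + 1)\<^sup>2 * beam_coeff \<beta> (Suc c) (Suc c) =
           (1 / 4 + 2 * \<beta> * (2 * real c + 1)) * beam_coeff \<beta> c c - 2 * \<beta> * beam_coeff \<beta> c (c - 1)"
proof -
  show 1: "(real c + 1) * beam_coeff \<beta> (Suc c) c = beam_coeff \<beta> c c / 2"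
    using beam_coeff_step_left[of c c \<beta>] assms by simp
  show "(real c + 1) * beam_coeff \<beta> c (Suc c) = beam_coeff \<beta> c c / 2"
    using beam_coeff_step_right[of c c \<beta>] assms by simp
  have 2: "(real c + 1) * beam_coeff \<beta> (Suc c) (c - 1) = beam_coeff \<beta> c (c - 1) - real c * beam_coeff \<beta> c c"
  proof (cases "c = 1")
    case True
    then show ?thesis
      by (simp add: beam_coeff_def beam_poly.simps numeral_2_eq_2 field_simps)
  next
    case False
    then have "1 \<le> c - 1" using assms by simp
    from beam_coeff_sum[OF assms(1) this, of \<beta>] show ?thesis
      using assms by (simp add: of_nat_diff)
  qed
  have 3: "(real c + 1) * beam_coeff \<beta> (Suc c) (Suc c) = beam_coeff \<beta> (Suc c) c / 2
      + 2 * \<beta> * (beam_coeff \<beta> c c - beam_coeff \<beta> (Suc c) (c - 1))"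
    using beam_coeff_step_right[of "Suc c" c \<beta>] assms by simp
  have "(real c + 1)\<^sup>2 * beam_coeff \<beta> (Suc c) (Suc c) =
      (real c + 1) * ((real c + 1) * beam_coeff \<beta> (Suc c) (Suc c))"
    by (simp add: power2_eq_square)
  also have "\<dots> = ((real c + 1) * beam_coeff \<beta> (Suc c) c) / 2 + 2 * \<beta> * ((real c + 1) * beam_coeff \<beta> c c
      - (real c + 1) * beam_coeff \<beta> (Suc c) (c - 1))"
    unfolding 3 by (simp add: algebra_simps)
  also have "\<dots> = (1 / 4 + 2 * \<beta> * (2 * real c + 1)) * beam_coeff \<beta> c c - 2 * \<beta> * beam_coeff \<beta> c (c - 1)"
    unfolding 1 2 by (simp add: algebra_simps)
  finally show "(real c + 1)\<^sup>2 * beam_coeff \<beta> (Suc c) (Suc c) =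
           (1 / 4 + 2 * \<beta> * (2 * real c + 1)) * beam_coeff \<beta> c c - 2 * \<beta> * beam_coeff \<beta> c (c - 1)" .
qed

text \<open>
  The ratio \<open>z / x\<close> could a priori follow the recessive solution, where it is about \<open>2 c\<close>.  It
  stays below this by the factor \<open>1 / (1 + 8 \<beta>)\<close>: equality holds at \<open>c = 1\<close>, and the recursion
  preserves the bound.
\<close>

lemma beam_coeff_diagonal:
  assumes "\<beta> > 0" "c \<ge> 1"
  shows "beam_coeff \<beta> c c > 0 \<and> beam_coeff \<beta> (c - 1) c = beam_coeff \<beta> c (c - 1) \<and>
    (1 + 8 * \<beta>) * beam_coeff \<beta> c (c - 1) \<le> 2 * real c * beam_coeff \<beta> c c"
  using assms(2)
proof (induction c rule: nat_induct_at_least)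
  case base
  show ?case using assms(1)
    by (simp add: beam_coeff_def beam_poly.simps numeral_2_eq_2 field_simps)
next
  case (Suc c)
  define x x' z where "x = beam_coeff \<beta> c c" and "x' = beam_coeff \<beta> (Suc c) (Suc c)"
    and "z = beam_coeff \<beta> c (c - 1)"
  have IH: "x > 0" "(1 + 8 * \<beta>) * z \<le> 2 * real c * x"
    using Suc.IH by (auto simp: x_def z_def)
  note step = beam_coeff_diagonal_Suc[OF Suc.hyps, of \<beta>, folded x_def x'_def z_def]
  have z: "z \<le> 2 * real c * x"
  proof (cases "z \<ge> 0")
    case True
    then have "z \<le> (1 + 8 * \<beta>) * z" using assms(1) by (simp add: algebra_simps)
    then show ?thesis using IH by linarith
  next
    case False
    moreover have "0 \<le> 2 * real c * x" using IH by simp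
    ultimately show ?thesis by linarith
  qed
  have "(1 / 4 + 2 * \<beta>) * x = (1 / 4 + 2 * \<beta> * (2 * real c + 1)) * x - 2 * \<beta> * (2 * real c * x)"
    by (simp add: algebra_simps)
  also have "\<dots> \<le> (1 / 4 + 2 * \<beta> * (2 * real c + 1)) * x - 2 * \<beta> * z"
    using z assms(1) by (intro diff_left_mono mult_left_mono) auto
  also have "\<dots> = (real c + 1)\<^sup>2 * x'"
    using step(3) Suc.IH by (simp add: z_def)
  finally have x': "(1 / 4 + 2 * \<beta>) * x \<le> (real c + 1)\<^sup>2 * x'" .
  have "0 < (1 / 4 + 2 * \<beta>) * x" using IH assms(1) by (intro mult_pos_pos add_pos_pos) auto
  then have pos: "x' > 0"
    using x' by (metis less_le_trans zero_less_mult_pos zero_less_power2 of_nat_Suc of_nat_neq_0 add.commute)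
  have eq: "beam_coeff \<beta> (Suc c) c = x / 2 / (real c + 1)" "beam_coeff \<beta> c (Suc c) = x / 2 / (real c + 1)"
    using step(1,2) Suc.IH by (auto simp: z_def field_simps)
  have "(1 + 8 * \<beta>) * (x / 2 / (real c + 1)) = 2 / (real c + 1) * ((1 / 4 + 2 * \<beta>) * x)"
    by (simp add: field_simps)
  also have "\<dots> \<le> 2 / (real c + 1) * ((real c + 1)\<^sup>2 * x')"
    using x' by (intro mult_left_mono) auto
  also have "\<dots> = 2 * real (Suc c) * x'"
    by (simp add: power2_eq_square field_simps)
  finally show ?case using pos eq by (simp add: x'_def)
qed

text \<open>
  The linear bound on \<open>z / x\<close> improves itself to a constant one: being a definite fraction below
  \<open>2 c\<close>, it leaves a denominator that grows linearly in the recursion for the next ratio.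
\<close>

lemma beam_coeff_diagonal_dominant:
  assumes "\<beta> > 0"
  shows "\<exists>C\<ge>0. \<forall>c\<ge>2. dominant C (real c) (beam_coeff \<beta> c c) (beam_coeff \<beta> (c - 1) c) (beam_coeff \<beta> c (c - 1))"
proof -
  define e where "e = min (1 / 4) (4 * \<beta> * (1 - 1 / (1 + 8 * \<beta>)))"
  have e: "e > 0" using assms by (simp add: e_def field_simps)
  have "dominant (1 / e) (real (Suc c)) (beam_coeff \<beta> (Suc c) (Suc c)) (beam_coeff \<beta> c (Suc c)) (beam_coeff \<beta> (Suc c) c)"
    if c: "c \<ge> 1" for c
  proof -
    define x x' z where "x = beam_coeff \<beta> c c" and "x' = beam_coeff \<beta> (Suc c) (Suc c)"
      and "z = beam_coeff \<beta> c (c - 1)"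
    have d: "x > 0" "(1 + 8 * \<beta>) * z \<le> 2 * real c * x" "beam_coeff \<beta> (c - 1) c = beam_coeff \<beta> c (c - 1)"
      using beam_coeff_diagonal[OF assms c] by (auto simp: x_def z_def)
    have x'0: "x' > 0" using beam_coeff_diagonal[OF assms, of "Suc c"] by (simp add: x'_def)
    note step = beam_coeff_diagonal_Suc[OF c d(3), folded x_def x'_def z_def]
    define \<kappa> where "\<kappa> = 1 / (1 + 8 * \<beta>)"
    have z: "z \<le> 2 * real c * x * \<kappa>"
      using d(2) assms by (simp add: \<kappa>_def field_simps)
    have "e * (real c + 1) \<le> (1 / 4 + 2 * \<beta>) + 4 * \<beta> * (1 - \<kappa>) * real c"
    proof -
      have "e * real c \<le> 4 * \<beta> * (1 - \<kappa>) * real c"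
        by (intro mult_right_mono) (auto simp: e_def \<kappa>_def)
      moreover have "e \<le> 1 / 4 + 2 * \<beta>" using assms by (simp add: e_def)
      ultimately show ?thesis by (simp add: algebra_simps)
    qed
    from mult_right_mono[OF this, of x] d(1)
    have "e * (real c + 1) * x \<le> (1 / 4 + 2 * \<beta> * (2 * real c + 1)) * x - 2 * \<beta> * (2 * real c * x * \<kappa>)"
      by (simp add: algebra_simps)
    also have "\<dots> \<le> (1 / 4 + 2 * \<beta> * (2 * real c + 1)) * x - 2 * \<beta> * z"
      using z assms by (intro diff_left_mono mult_left_mono) auto
    also have "\<dots> = (real c + 1) * ((real c + 1) * x')"
      using step(3) by (simp add: power2_eq_square mult_ac)
    finally have "(real c + 1) * (e * x) \<le> (real c + 1) * ((real c + 1) * x')"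
      by (simp add: mult_ac)
    then have "e * x \<le> (real c + 1) * x'"
      by (subst (asm) mult_le_cancel_left_pos) auto
    then have x: "x / (real c + 1) \<le> x' / e" using e by (simp add: field_simps)
    have eq: "beam_coeff \<beta> (Suc c) c = x / (real c + 1) / 2" "beam_coeff \<beta> c (Suc c) = x / (real c + 1) / 2"
      using step(1,2) by (auto simp: field_simps)
    define t where "t = x / (real c + 1)"
    have "t \<ge> 0" "t \<le> x' / e" using x d(1) by (auto simp: t_def)
    then show ?thesis
      unfolding dominant_def eq t_def[symmetric] using x'0 by (simp add: x'_def[symmetric])
  qed
  then have "\<forall>c\<ge>2. dominant (1 / e) (real c) (beam_coeff \<beta> c c) (beam_coeff \<beta> (c - 1) c) (beam_coeff \<beta> c (c - 1))"
    by (metis One_nat_def Suc_1 Suc_le_D Suc_le_mono diff_Suc_1)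
  then show ?thesis using e by (intro exI[of _ "1 / e"]) auto
qed

text \<open>
  Induction on the distance from the main diagonal, on both sides of it.  Exchanging the two
  indices exchanges \<open>y\<close> and \<open>z\<close>, so that one step lemma serves both directions.
\<close>

lemma beam_coeff_dominant:
  assumes "\<beta> > 0"
  shows "\<exists>C\<ge>0. \<exists>c0. \<forall>c\<ge>c0.
     dominant C (real c) (beam_coeff \<beta> (c + k) c) (beam_coeff \<beta> (c + k - 1) c) (beam_coeff \<beta> (c + k) (c - 1)) \<and>
     dominant C (real c) (beam_coeff \<beta> c (c + k)) (beam_coeff \<beta> (c - 1) (c + k)) (beam_coeff \<beta> c (c + k - 1))"
proof (induction k)
  case 0
  then show ?case using beam_coeff_diagonal_dominant[OF assms] by auto
next
  case (Suc k)
  then obtain C c0 where C: "C \<ge> 0" and IH: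
    "\<And>c. c \<ge> c0 \<Longrightarrow> dominant C (real c) (beam_coeff \<beta> (c + k) c) (beam_coeff \<beta> (c + k - 1) c) (beam_coeff \<beta> (c + k) (c - 1))"
    "\<And>c. c \<ge> c0 \<Longrightarrow> dominant C (real c) (beam_coeff \<beta> c (c + k)) (beam_coeff \<beta> (c - 1) (c + k)) (beam_coeff \<beta> c (c + k - 1))"
    by blast
  obtain C' c1 where C': "C' \<ge> 0" and step:
    "\<And>c a x y z. c \<ge> c1 \<Longrightarrow> c \<le> a \<Longrightarrow> a \<le> c + real k \<Longrightarrow> dominant C c x y z \<Longrightarrow>
       dominant C' c ((x / 2 - 2 * \<beta> * (y - z)) / (a + 1)) x ((z - c * x) / (a + 1))"
    using dominant_step[OF assms C, of "real k"] by blast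
  have "dominant C' (real c) (beam_coeff \<beta> (c + Suc k) c) (beam_coeff \<beta> (c + Suc k - 1) c) (beam_coeff \<beta> (c + Suc k) (c - 1)) \<and>
     dominant C' (real c) (beam_coeff \<beta> c (c + Suc k)) (beam_coeff \<beta> (c - 1) (c + Suc k)) (beam_coeff \<beta> c (c + Suc k - 1))"
    if c: "c \<ge> max (max c0 2) (nat \<lceil>c1\<rceil>)" for c
  proof
    have c': "c \<ge> c0" "c \<ge> 2" "real c \<ge> c1" using c by (auto simp: nat_le_iff ceiling_le_iff)
    note sl = beam_coeff_step_left[of "c + k" c \<beta>] and sr = beam_coeff_step_right[of c "c + k" \<beta>]
    have c1': "1 \<le> c + k" "1 \<le> c - 1" using c' by auto
    have s1: "(real c + real k + 1) * beam_coeff \<beta> (c + Suc k) (c - 1) =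
        beam_coeff \<beta> (c + k) (c - 1) - real c * beam_coeff \<beta> (c + k) c"
      using beam_coeff_sum[OF c1', of \<beta>] c' by (simp add: of_nat_diff)
    have s2: "(real c + real k + 1) * beam_coeff \<beta> (c - 1) (c + Suc k) =
        beam_coeff \<beta> (c - 1) (c + k) - real c * beam_coeff \<beta> c (c + k)"
      using beam_coeff_sum[OF c1'(2,1), of \<beta>] c' by (simp add: of_nat_diff)
    show "dominant C' (real c) (beam_coeff \<beta> (c + Suc k) c) (beam_coeff \<beta> (c + Suc k - 1) c) (beam_coeff \<beta> (c + Suc k) (c - 1))"
    proof -
      have "beam_coeff \<beta> (c + Suc k) c = (beam_coeff \<beta> (c + k) c / 2 -
          2 * \<beta> * (beam_coeff \<beta> (c + k - 1) c - beam_coeff \<beta> (c + k) (c - 1))) / (real c + real k + 1)"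
        using sl c' by (simp add: eq_divide_eq mult_ac)
      moreover have "beam_coeff \<beta> (c + Suc k) (c - 1) =
          (beam_coeff \<beta> (c + k) (c - 1) - real c * beam_coeff \<beta> (c + k) c) / (real c + real k + 1)"
        using s1 by (simp add: eq_divide_eq mult_ac)
      ultimately show ?thesis
        using step[OF c'(3) _ _ IH(1)[OF c'(1)], of "real c + real k"] by simp
    qed
    show "dominant C' (real c) (beam_coeff \<beta> c (c + Suc k)) (beam_coeff \<beta> (c - 1) (c + Suc k)) (beam_coeff \<beta> c (c + Suc k - 1))"
    proof -
      have "beam_coeff \<beta> c (c + Suc k) = (beam_coeff \<beta> c (c + k) / 2 -
          2 * \<beta> * (beam_coeff \<beta> c (c + k - 1) - beam_coeff \<beta> (c - 1) (c + k))) / (real c + real k + 1)"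
        using sr c' by (simp add: eq_divide_eq mult_ac algebra_simps)
      moreover have "beam_coeff \<beta> (c - 1) (c + Suc k) =
          (beam_coeff \<beta> (c - 1) (c + k) - real c * beam_coeff \<beta> c (c + k)) / (real c + real k + 1)"
        using s2 by (simp add: eq_divide_eq mult_ac)
      ultimately show ?thesis
        using step[OF c'(3) _ _ IH(2)[OF c'(1), unfolded dominant_swap[of _ _ _ "beam_coeff \<beta> (c - 1) (c + k)"]],
            of "real c + real k"]
        by (subst dominant_swap) simp
    qed
  qed
  then show ?case using C' by blast
qed

lemma eventually_beam_det_nonzero:
  assumes "\<beta> > 0"
  shows "\<exists>c0. \<forall>c\<ge>c0. beam_det \<beta> (c + k) c \<noteq> 0 \<and> beam_det \<beta> c (c + k) \<noteq> 0"
proof -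
  obtain C c0 where C: "C \<ge> 0" and dom:
    "\<And>c. c \<ge> c0 \<Longrightarrow> dominant C (real c) (beam_coeff \<beta> (c + k) c) (beam_coeff \<beta> (c + k - 1) c) (beam_coeff \<beta> (c + k) (c - 1))"
    "\<And>c. c \<ge> c0 \<Longrightarrow> dominant C (real c) (beam_coeff \<beta> c (c + k)) (beam_coeff \<beta> (c - 1) (c + k)) (beam_coeff \<beta> c (c + k - 1))"
    using beam_coeff_dominant[OF assms] by blast
  obtain c1 where c1: "\<And>c j x y z. c \<ge> c1 \<Longrightarrow> j \<ge> c \<Longrightarrow> dominant C c x y z \<Longrightarrow>
      2 * j * x\<^sup>2 - x * z + 4 * \<beta> * z * (z - y) > 0"
    using dominant_imp_form_pos[OF assms C] by blast
  have "beam_det \<beta> (c + k) c \<noteq> 0 \<and> beam_det \<beta> c (c + k) \<noteq> 0"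
    if c: "c \<ge> max (max c0 3) (nat \<lceil>c1\<rceil>)" for c
  proof -
    have c': "c \<ge> c0" "c \<ge> 3" "real c \<ge> c1" using c by (auto simp: nat_le_iff ceiling_le_iff)
    have "4 * \<beta> * (real (c + k) + 1) * beam_det \<beta> (c + k) c > 0"
      using beam_det_eq[of "c + k" c \<beta>] c1[OF c'(3) order_refl dom(1)[OF c'(1)]] c'
      by simp
    moreover have "4 * \<beta> * (real c + 1) * beam_det \<beta> c (c + k) > 0"
      using beam_det_eq[of c "c + k" \<beta>] c1[OF c'(3) _ dom(2)[OF c'(1)], of "real (c + k)"] c'
      by simp
    ultimately show ?thesis by auto
  qed
  then show ?thesis by blast
qed

section \<open>Functions on the disk and their moments\<close>

definition complex_coord :: "real^2 \<Rightarrow> complex" where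
  "complex_coord x = Complex (x $ 1) (x $ 2)"

definition disk_function :: "(real^2 \<Rightarrow> 'a::real_normed_vector) \<Rightarrow> bool" where
  "disk_function G \<longleftrightarrow> continuous_on UNIV G \<and> (\<forall>x. norm x \<ge> 1 \<longrightarrow> G x = 0)"

lemma continuous_on_complex_coord [continuous_intros]: "continuous_on S complex_coord"
  unfolding complex_coord_def by (intro continuous_intros)

lemma norm_complex_coord: "norm (complex_coord x) = norm x"
  by (simp add: complex_coord_def norm_vec_def L2_set_def UNIV_2 complex_norm sum_2)

lemma integrable_disk_function:
  fixes F G :: "real^2 \<Rightarrow> 'a::{real_normed_algebra,banach,second_countable_topology}"
  assumes "disk_function G" "continuous_on UNIV F"
  shows "integrable lborel (\<lambda>x. F x * G x)"
proof -
  have "integrable lborel (\<lambda>x. indicator (cball 0 1) x *\<^sub>R (F x * G x))"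
    using assms unfolding disk_function_def
    by (intro borel_integrable_compact continuous_on_mult) (auto intro: continuous_on_subset)
  moreover have "(\<lambda>x. indicator (cball 0 1) x *\<^sub>R (F x * G x)) = (\<lambda>x. F x * G x)"
    using assms by (auto simp: disk_function_def fun_eq_iff indicator_def)
  ultimately show ?thesis by simp
qed

definition moment :: "(real^2 \<Rightarrow> complex) \<Rightarrow> nat \<Rightarrow> nat \<Rightarrow> complex" where
  "moment G a c = (LINT x|lborel. complex_coord x ^ a * cnj (complex_coord x) ^ c * G x)"

lemma integral_radial_poly_eq_0:
  fixes q :: "complex poly"
  assumes G: "disk_function G" and m: "\<And>j. moment G (a + j) (c + j) = 0"
  shows "(LINT x|lborel. complex_coord x ^ a * cnj (complex_coord x) ^ c *
            poly q (complex_of_real ((norm x)\<^sup>2)) * G x) = 0"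
proof -
  have "complex_coord x ^ a * cnj (complex_coord x) ^ c * poly q (complex_of_real ((norm x)\<^sup>2)) * G x =
     (\<Sum>i\<le>degree q. coeff q i * (complex_coord x ^ (a + i) * cnj (complex_coord x) ^ (c + i) * G x))" for x
  proof -
    have "complex_of_real ((norm x)\<^sup>2) = complex_coord x * cnj (complex_coord x)"
      using complex_norm_square[of "complex_coord x"] by (simp add: norm_complex_coord)
    then show ?thesis
      by (simp add: poly_altdef sum_distrib_left sum_distrib_right power_mult_distrib power_add mult_ac)
  qed
  then have "(LINT x|lborel. complex_coord x ^ a * cnj (complex_coord x) ^ c *
            poly q (complex_of_real ((norm x)\<^sup>2)) * G x) =
     (LINT x|lborel. (\<Sum>i\<le>degree q. coeff q i * (complex_coord x ^ (a + i) * cnj (complex_coord x) ^ (c + i) * G x)))"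
    by simp
  also have "\<dots> = (\<Sum>i\<le>degree q. coeff q i * moment G (a + i) (c + i))"
    unfolding moment_def
    by (subst Bochner_Integration.integral_sum)
       (auto intro!: integrable_disk_function[OF G] integrable_mult_right continuous_intros)
  also have "\<dots> = 0" by (simp add: m)
  finally show ?thesis .
qed

text \<open>
  The cutoff \<open>(1 - (1 - t) ^ k) ^ J\<close> with \<open>t = \<bar>z\<bar>\<^sup>2\<close> is \<open>t ^ J\<close> times a polynomial in \<open>t\<close>, so it
  only produces moments known to vanish; as \<open>k\<close> grows it tends to one boundedly except at the
  origin, and dominated convergence applies.
\<close>

lemma moment_eq_0_if_eventually:
  assumes G: "disk_function G" and m: "\<And>j. j \<ge> J \<Longrightarrow> moment G (a + j) (c + j) = 0"
  shows "moment G a c = 0"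
proof -
  let ?z = complex_coord
  define t where "t x = (norm (x::real^2))\<^sup>2" for x
  define M where "M x = ?z x ^ a * cnj (?z x) ^ c * G x" for x
  define s where "s k x = complex_of_real ((1 - (1 - t x) ^ k) ^ J) * M x" for k :: nat and x
  have int_s: "integral\<^sup>L lborel (s k) = 0" for k
  proof -
    define q :: "complex poly" where "q = (\<Sum>i<k. [:1, -1:] ^ i) ^ J"
    have "s k x = ?z x ^ (a + J) * cnj (?z x) ^ (c + J) * poly q (complex_of_real ((norm x)\<^sup>2)) * G x" for x
    proof -
      have "1 - (1 - t x) ^ k = t x * (\<Sum>i<k. (1 - t x) ^ i)"
        using power_diff_1_eq[of "1 - t x" k] by (simp add: algebra_simps)
      then have "complex_of_real ((1 - (1 - t x) ^ k) ^ J) =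
          complex_of_real (t x) ^ J * poly q (complex_of_real ((norm x)\<^sup>2))"
        by (simp add: q_def poly_sum power_mult_distrib t_def)
      moreover have "complex_of_real (t x) = ?z x * cnj (?z x)"
        using complex_norm_square[of "?z x"] by (simp add: t_def norm_complex_coord)
      ultimately show ?thesis
        by (simp add: s_def M_def power_mult_distrib power_add mult_ac)
    qed
    then have "s k = (\<lambda>x. ?z x ^ (a + J) * cnj (?z x) ^ (c + J) * poly q (complex_of_real ((norm x)\<^sup>2)) * G x)"
      by (rule ext)
    moreover have "moment G (a + J + j) (c + J + j) = 0" for j
      using m[of "J + j"] by (simp add: add_ac)
    ultimately show ?thesis
      using integral_radial_poly_eq_0[OF G, of "a + J" "c + J" q] by simp
  qed
  have M: "integrable lborel M"
    unfolding M_def by (intro integrable_disk_function G continuous_intros)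
  have [measurable]: "M \<in> borel_measurable borel"
    using M by simp
  have [measurable]: "t \<in> borel_measurable borel"
    unfolding t_def by simp
  have s_meas: "s k \<in> borel_measurable borel" for k
    unfolding s_def[abs_def] by measurable
  have "(\<lambda>k. integral\<^sup>L lborel (s k)) \<longlonglongrightarrow> integral\<^sup>L lborel M"
  proof (rule integral_dominated_convergence[where w = "\<lambda>x. norm (M x)"])
    show "AE x in lborel. (\<lambda>k. s k x) \<longlonglongrightarrow> M x"
    proof -
      have "AE x in lborel. x \<noteq> (0 :: real^2)"
        by (rule AE_lborel_singleton)
      then show ?thesis
      proof eventually_elim
        case (elim x)
        show ?case
        proof (cases "norm x < 1")
          case True
          then have "0 < t x" "t x < 1" using elim by (auto simp: t_def power_less_one_iff)
          then have "norm (1 - t x) < 1" by simp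
          then have "(\<lambda>k. (1 - t x) ^ k) \<longlonglongrightarrow> 0"
            by (rule LIMSEQ_power_zero)
          then have "(\<lambda>k. s k x) \<longlonglongrightarrow> complex_of_real ((1 - 0) ^ J) * M x"
            unfolding s_def
            by (intro tendsto_mult tendsto_of_real tendsto_power tendsto_diff tendsto_const)
          then show ?thesis by simp
        next
          case False
          then have "M x = 0" using G by (simp add: M_def disk_function_def)
          then show ?thesis by (simp add: s_def)
        qed
      qed
    qed
    show "AE x in lborel. norm (s k x) \<le> norm (M x)" for k
    proof (rule AE_I2)
      fix x :: "real^2"
      show "norm (s k x) \<le> norm (M x)"
      proof (cases "norm x < 1")
        case True
        then have "t x \<le> 1" "t x \<ge> 0" by (auto simp: t_def power_le_one)
        then have "0 \<le> (1 - t x) ^ k" "(1 - t x) ^ k \<le> 1"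
          by (auto intro!: power_le_one)
        then have "\<bar>(1 - (1 - t x) ^ k) ^ J\<bar> \<le> 1"
          by (simp add: power_abs power_le_one)
        then show ?thesis
          by (simp add: s_def norm_mult mult_left_le_one_le del: of_real_power of_real_diff)
      next
        case False
        then have "M x = 0" using G by (simp add: M_def disk_function_def)
        then show ?thesis by (simp add: s_def)
      qed
    qed
  qed (use M s_meas in auto)
  then have "integral\<^sup>L lborel M = 0"
    by (simp add: int_s LIMSEQ_const_iff)
  then show ?thesis by (simp add: moment_def M_def[abs_def])
qed
text \<open>
  Products of polynomial functions require the claim for an arbitrary further factor \<open>Q\<close>: the
  induction hypothesis for one factor is then applied with the other one absorbed into \<open>Q\<close>.
\<close>

lemma integral_real_polynomial_mult_eq_0:
  assumes "real_polynomial_function P" and G: "disk_function G" and "continuous_on UNIV Q"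
    and "\<And>a c. (LINT x|lborel. Q x * (complex_coord x ^ a * cnj (complex_coord x) ^ c) * G x) = 0"
  shows "(LINT x|lborel. complex_of_real (P x) * Q x * (complex_coord x ^ a * cnj (complex_coord x) ^ c) * G x) = 0"
  using assms(1,3,4)
proof (induction P arbitrary: Q a c rule: real_polynomial_function.induct)
  case (linear f)
  \<comment> \<open>A real linear form is \<open>\<alpha> * z + cnj \<alpha> * cnj z\<close>.\<close>
  define \<alpha> where "\<alpha> = Complex (f (axis 1 1)) (- f (axis 2 1)) / 2"
  have lin: "linear f" by (rule bounded_linear.linear[OF linear(1)])
  have f: "f x = x $ 1 * f (axis 1 1) + x $ 2 * f (axis 2 1)" for x :: "real^2"
  proof -
    have "x = x $ 1 *\<^sub>R axis 1 1 + x $ 2 *\<^sub>R axis 2 1"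
      by (simp add: vec_eq_iff axis_def forall_2)
    then have "f x = f (x $ 1 *\<^sub>R axis 1 1 + x $ 2 *\<^sub>R axis 2 1)" by (rule arg_cong)
    then show ?thesis by (simp add: linear_add[OF lin] linear_scale[OF lin])
  qed
  have "complex_of_real (f x) = \<alpha> * complex_coord x + cnj \<alpha> * cnj (complex_coord x)" for x
    unfolding f[of x] by (simp add: \<alpha>_def complex_coord_def complex_eq_iff field_simps)
  then have "(\<lambda>x. complex_of_real (f x) * Q x * (complex_coord x ^ a * cnj (complex_coord x) ^ c) * G x) =
      (\<lambda>x. \<alpha> * (Q x * (complex_coord x ^ Suc a * cnj (complex_coord x) ^ c) * G x) +
      cnj \<alpha> * (Q x * (complex_coord x ^ a * cnj (complex_coord x) ^ Suc c) * G x))"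
    by (simp add: fun_eq_iff algebra_simps)
  moreover have "integrable lborel (\<lambda>x. Q x * (complex_coord x ^ i * cnj (complex_coord x) ^ j) * G x)" for i j
    by (intro integrable_disk_function[OF G] continuous_on_mult continuous_on_power continuous_on_cnj
        continuous_on_complex_coord linear(2))
  ultimately show ?case
    using linear(3)[of "Suc a" c] linear(3)[of a "Suc c"]
    by (simp only:) (subst Bochner_Integration.integral_add; simp del: power_Suc)
next
  case (const r)
  have "(\<lambda>x. complex_of_real r * Q x * (complex_coord x ^ a * cnj (complex_coord x) ^ c) * G x) =
    (\<lambda>x. complex_of_real r * (Q x * (complex_coord x ^ a * cnj (complex_coord x) ^ c) * G x))"
    by (simp add: mult.assoc)
  then show ?case using const(2)[of a c] by (simp only:) simp
next
  case (add f g)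
  have int: "integrable lborel (\<lambda>x. complex_of_real (h x) * Q x * (complex_coord x ^ a * cnj (complex_coord x) ^ c) * G x)"
    if "real_polynomial_function h" for h
    by (intro integrable_disk_function[OF G] continuous_on_mult continuous_on_power continuous_on_cnj
        continuous_on_complex_coord add.prems continuous_on_of_real
        continuous_on_polymonial_function that[unfolded real_polynomial_function_eq])
  have "(\<lambda>x. complex_of_real (f x + g x) * Q x * (complex_coord x ^ a * cnj (complex_coord x) ^ c) * G x) =
    (\<lambda>x. complex_of_real (f x) * Q x * (complex_coord x ^ a * cnj (complex_coord x) ^ c) * G x
       + complex_of_real (g x) * Q x * (complex_coord x ^ a * cnj (complex_coord x) ^ c) * G x)"
    by (simp add: fun_eq_iff distrib_right)
  then show ?case
    using add.IH(1)[OF add.prems, of a c] add.IH(2)[OF add.prems, of a c]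
    by (simp only: Bochner_Integration.integral_add[OF int[OF add.hyps(1)] int[OF add.hyps(2)]]) simp
next
  case (mult f g)
  have "continuous_on UNIV (\<lambda>x. complex_of_real (g x) * Q x)"
    by (intro continuous_on_mult mult.prems continuous_on_of_real
        continuous_on_polymonial_function mult.hyps(2)[unfolded real_polynomial_function_eq])
  from mult.IH(1)[OF this mult.IH(2)[OF mult.prems], of a c]
  show ?case by (simp add: mult.assoc)
qed


text \<open>
  Real and imaginary part are orthogonal to all polynomials, hence by uniform approximation to
  themselves.
\<close>

lemma disk_function_eq_0_if_moments_eq_0:
  assumes G: "disk_function G" and m: "\<And>a c. moment G a c = 0"
  shows "G = (\<lambda>_. 0)"
proof -
  have P: "(LINT x|lborel. complex_of_real (P x) * G x) = 0" if "real_polynomial_function P" for P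
    using integral_real_polynomial_mult_eq_0[OF that G, of "\<lambda>_. 1" 0 0] m by (simp add: moment_def)
  have zero: "g = (\<lambda>_. 0)" if g: "disk_function g" and gP: "\<And>P. real_polynomial_function P \<Longrightarrow> (LINT x|lborel. P x * g x) = 0"
    for g :: "real^2 \<Rightarrow> real"
  proof -
    have cont: "continuous_on UNIV g" using g by (simp add: disk_function_def)
    have int: "integrable lborel (\<lambda>x. \<bar>g x\<bar>)"
      using integrable_disk_function[OF g, of "\<lambda>_. 1"] by simp
    have int2: "integrable lborel (\<lambda>x. g x * g x)"
      by (rule integrable_disk_function[OF g cont])
    have le: "(LINT x|lborel. g x * g x) \<le> e * (LINT x|lborel. \<bar>g x\<bar>)" if "e > 0" for e
    proof -
      obtain P where P: "real_polynomial_function P" "\<And>x. x \<in> cball 0 1 \<Longrightarrow> \<bar>g x - P x\<bar> < e"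
        using Stone_Weierstrass_real_polynomial_function[of "cball 0 1" g e] cont \<open>e > 0\<close>
        by (metis compact_cball continuous_on_subset top_greatest)
      have cP: "continuous_on UNIV P"
        using P(1) by (auto intro: continuous_on_polymonial_function simp: real_polynomial_function_eq)
      have "(LINT x|lborel. g x * g x) = (LINT x|lborel. g x * g x) - (LINT x|lborel. P x * g x)"
        using gP[OF P(1)] by simp
      also have "\<dots> = (LINT x|lborel. g x * g x - P x * g x)"
        by (intro Bochner_Integration.integral_diff[symmetric] int2 integrable_disk_function g cP)
      also have "\<dots> \<le> (LINT x|lborel. e * \<bar>g x\<bar>)"
      proof (rule integral_mono)
        show "integrable lborel (\<lambda>x. g x * g x - P x * g x)"
          by (intro Bochner_Integration.integrable_diff int2 integrable_disk_function g cP)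
        show "integrable lborel (\<lambda>x. e * \<bar>g x\<bar>)" using int by simp
        show "g x * g x - P x * g x \<le> e * \<bar>g x\<bar>" for x
        proof (cases "norm x < 1")
          case True
          have "g x * g x - P x * g x = (g x - P x) * g x" by (simp add: algebra_simps)
          also have "\<dots> \<le> \<bar>g x - P x\<bar> * \<bar>g x\<bar>" by (metis abs_ge_self abs_mult)
          also have "\<dots> \<le> e * \<bar>g x\<bar>"
            using P(2)[of x] True by (intro mult_right_mono) auto
          finally show ?thesis .
        next
          case False
          then show ?thesis using g by (simp add: disk_function_def)
        qed
      qed
      finally show ?thesis by simp
    qed
    have "(LINT x|lborel. g x * g x) \<le> 0"
    proof (rule field_le_epsilon)
      fix e :: real assume "e > 0"
      define I where "I = (LINT x|lborel. \<bar>g x\<bar>)"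
      have "I \<ge> 0" by (simp add: I_def)
      then have "e / (I + 1) * I \<le> e" using \<open>e > 0\<close> by (simp add: field_simps)
      then show "(LINT x|lborel. g x * g x) \<le> 0 + e"
        using le[of "e / (I + 1)"] \<open>e > 0\<close> \<open>I \<ge> 0\<close> unfolding I_def[symmetric] by force
    qed
    moreover have "(LINT x|lborel. g x * g x) \<ge> 0" by simp
    ultimately have "(LINT x|lborel. g x * g x) = 0" by linarith
    then have "AE x in lborel. g x * g x = 0"
      using integral_nonneg_eq_0_iff_AE[OF int2] by simp
    then have ae: "AE x in lborel. x \<notin> {x. g x \<noteq> 0}" by simp
    have op: "open {x. g x \<noteq> 0}"
      using cont by (simp add: open_Collect_neq)
    have "{x. g x \<noteq> 0} \<in> null_sets lborel"
      using ae op by (subst AE_iff_null_sets) auto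
    then have "negligible {x. g x \<noteq> 0}"
      using negligible_iff_null_sets null_sets_completionI by blast
    then have "{x. g x \<noteq> 0} = {}"
      using open_not_negligible[OF op] by blast
    then show ?thesis by auto
  qed
  have int: "integrable lborel (\<lambda>x. complex_of_real (P x) * G x)" if "real_polynomial_function P" for P
    using that by (intro integrable_disk_function G continuous_intros)
      (auto intro: continuous_on_polymonial_function simp: real_polynomial_function_eq)
  have "(\<lambda>x. Re (G x)) = (\<lambda>_. 0)"
  proof (rule zero)
    show "disk_function (\<lambda>x. Re (G x))"
      using G by (auto simp: disk_function_def intro!: continuous_intros)
    show "(LINT x|lborel. P x * Re (G x)) = 0" if "real_polynomial_function P" for P
      using integral_Re[OF int[OF that]] P[OF that] by simp
  qed
  moreover have "(\<lambda>x. Im (G x)) = (\<lambda>_. 0)"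
  proof (rule zero)
    show "disk_function (\<lambda>x. Im (G x))"
      using G by (auto simp: disk_function_def intro!: continuous_intros)
    show "(LINT x|lborel. P x * Im (G x)) = 0" if "real_polynomial_function P" for P
      using integral_Im[OF int[OF that]] P[OF that] by simp
  qed
  ultimately show ?thesis by (simp add: fun_eq_iff complex_eq_iff)
qed

section \<open>Power series expansion of the beam exponential\<close>

definition homogenize :: "'a::comm_semiring_1 poly \<Rightarrow> nat \<Rightarrow> 'a \<Rightarrow> 'a \<Rightarrow> 'a" where
  "homogenize p n u v = (\<Sum>a\<le>n. coeff p a * u ^ a * v ^ (n - a))"

lemma homogenize_linear_mult:
  assumes "degree p \<le> n"
  shows "homogenize ([:r, s:] * p) (Suc n) u v = (r * v + s * u) * homogenize p n u v"
proof -
  have 1: "homogenize ([:r, s:] * p) (Suc n) u v =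
      (\<Sum>a\<le>Suc n. r * coeff p a * u ^ a * v ^ (Suc n - a)) +
      (\<Sum>a\<le>Suc n. s * coeff (pCons 0 p) a * u ^ a * v ^ (Suc n - a))"
  proof -
    have "coeff ([:r, s:] * p) a = r * coeff p a + s * coeff (pCons 0 p) a" for a
      by (cases a) simp_all
    then show ?thesis
      unfolding homogenize_def by (simp only: sum.distrib[symmetric] distrib_right)
  qed
  have 2: "(\<Sum>a\<le>Suc n. r * coeff p a * u ^ a * v ^ (Suc n - a)) = r * v * homogenize p n u v"
    using assms by (simp add: homogenize_def coeff_eq_0 sum_distrib_left Suc_diff_le mult_ac)
  have 3: "(\<Sum>a\<le>Suc n. s * coeff (pCons 0 p) a * u ^ a * v ^ (Suc n - a)) = s * u * homogenize p n u v"
    by (simp only: sum.atMost_Suc_shift) (simp add: homogenize_def sum_distrib_left mult_ac)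
  show ?thesis unfolding 1 2 3 by (simp add: distrib_right)
qed

lemma homogenize_diff:
  fixes p q :: "'a::comm_ring_1 poly"
  shows "homogenize (p - q) n u v = homogenize p n u v - homogenize q n u v"
  by (simp add: homogenize_def left_diff_distrib sum_subtractf)

lemma homogenize_smult: "homogenize (smult r p) n u v = r * homogenize p n u v"
  by (simp add: homogenize_def sum_distrib_left mult_ac)

text \<open>
  The power series of \<open>exp (t X\<^sup>2)\<close>.
\<close>

definition half_exp_fps :: "real \<Rightarrow> real fps" where
  "half_exp_fps t = Abs_fps (\<lambda>i. if even i then t ^ (i div 2) / fact (i div 2) else 0)"

lemma fps_deriv_half_exp_fps: "fps_deriv (half_exp_fps t) = fps_const (2 * t) * (fps_X * half_exp_fps t)"
proof (rule fps_ext)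
  fix n show "fps_nth (fps_deriv (half_exp_fps t)) n = fps_nth (fps_const (2 * t) * (fps_X * half_exp_fps t)) n"
  proof (cases n)
    case (Suc m)
    have "real (m + 2) * (t ^ Suc (m div 2) / fact (Suc (m div 2))) = 2 * t * (t ^ (m div 2) / fact (m div 2))"
      if "even m"
    proof -
      have "real (m + 2) = 2 * (real (m div 2) + 1)" using that by (auto elim!: evenE)
      moreover have "fact (Suc (m div 2)) = (real (m div 2) + 1) * fact (m div 2)" by simp
      moreover have "real (m div 2) + 1 \<noteq> 0" by linarith
      ultimately show ?thesis by (simp only: power_Suc) (simp add: divide_simps)
    qed
    then show ?thesis by (simp add: Suc half_exp_fps_def)
  qed (simp add: half_exp_fps_def)
qed

text \<open>
  The coefficient of \<open>\<tau> ^ n\<close> in \<open>exp (\<tau> p + b \<tau>\<^sup>2 q\<^sup>2)\<close>, a form of degree \<open>n\<close> in \<open>p\<close> and \<open>q\<close>.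
\<close>

definition beam_form :: "real \<Rightarrow> nat \<Rightarrow> real \<Rightarrow> real \<Rightarrow> real" where
  "beam_form b n p q = fps_nth (fps_exp p * half_exp_fps (b * q\<^sup>2)) n"

lemma beam_form_0: "beam_form b 0 p q = 1"
  by (simp add: beam_form_def half_exp_fps_def)

lemma beam_form_Suc_0: "beam_form b (Suc 0) p q = p"
  by (simp add: beam_form_def half_exp_fps_def fps_mult_nth)

lemma beam_form_Suc_Suc:
  "real (n + 2) * beam_form b (n + 2) p q = p * beam_form b (n + 1) p q + 2 * b * q\<^sup>2 * beam_form b n p q"
proof -
  let ?F = "fps_exp p * half_exp_fps (b * q\<^sup>2)"
  have "fps_deriv ?F = fps_const p * ?F + fps_const (2 * (b * q\<^sup>2)) * (fps_X * ?F)"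
    by (simp only: fps_deriv_mult fps_deriv_half_exp_fps fps_exp_deriv) (simp only: mult_ac add_ac)
  then have "fps_nth (fps_deriv ?F) (n + 1) =
      fps_nth (fps_const p * ?F + fps_const (2 * (b * q\<^sup>2)) * (fps_X * ?F)) (n + 1)"
    by (simp only:)
  also have "\<dots> = p * fps_nth ?F (n + 1) + 2 * (b * q\<^sup>2) * fps_nth ?F n"
    by (simp only: fps_add_nth fps_mult_left_const_nth fps_X_mult_nth) simp
  finally have "fps_nth (fps_deriv ?F) (n + 1) = p * fps_nth ?F (n + 1) + 2 * (b * q\<^sup>2) * fps_nth ?F n" .
  moreover have "fps_nth (fps_deriv ?F) (n + 1) = real (n + 2) * fps_nth ?F (n + 2)"
    by (simp only: fps_deriv_nth) simp
  ultimately show ?thesis unfolding beam_form_def by (simp only: mult.assoc)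
qed

text \<open>
  Both sides satisfy the same recursion, because \<open>Re u = (u + cnj u) / 2\<close> and
  \<open>(u - cnj u)\<^sup>2 = - 4 (Im u)\<^sup>2\<close>; this is where \<open>\<beta> = b / 4\<close> comes from.
\<close>

lemma of_real_beam_form:
  "complex_of_real (beam_form b n (Re u) (Im u)) = homogenize (map_poly of_real (beam_poly (b / 4) n)) n u (cnj u)"
proof (induction n rule: less_induct)
  case (less n)
  consider "n = 0" | "n = 1" | m where "n = m + 2"
    by (metis One_nat_def add_2_eq_Suc' not0_implies_Suc)
  then show ?case
  proof cases
    case 1
    then show ?thesis by (simp add: beam_form_0 homogenize_def)
  next
    case 2
    then show ?thesis by (simp add: beam_form_Suc_0 homogenize_def complex_eq_iff coeff_map_poly)
  next
    case 3
    define B where "B i = (map_poly of_real (beam_poly (b / 4) i) :: complex poly)" for i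
    define v where "v = cnj u"
    have IH: "complex_of_real (beam_form b (m + 1) (Re u) (Im u)) = homogenize (B (m + 1)) (m + 1) u v"
      "complex_of_real (beam_form b m (Re u) (Im u)) = homogenize (B m) m u v"
      using less 3 by (auto simp: B_def v_def)
    have deg: "degree (B i) \<le> i" for i
      using degree_beam_poly[of "b / 4" i] by (simp add: B_def degree_map_poly)
    have deg': "degree ([:-1, 1:] * B m) \<le> Suc m"
      using degree_mult_le[of "[:-1, 1:]" "B m"] deg[of m] by (simp del: mult_pCons_left)
    have rec: "smult (of_nat (m + 2)) (B (m + 2)) =
       [:1/2, 1/2:] * B (m + 1) - smult (of_real (b / 2)) ([:-1, 1:] * ([:-1, 1:] * B m))"
    proof (rule poly_eqI)
      fix k
      show "coeff (smult (of_nat (m + 2)) (B (m + 2))) k = coeff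
          ([:1/2, 1/2:] * B (m + 1) - smult (of_real (b / 2)) ([:-1, 1:] * ([:-1, 1:] * B m))) k"
        using arg_cong[OF beam_poly_Suc_Suc[of m "b / 4"], of "\<lambda>p. complex_of_real (coeff p k)"]
        by (simp add: B_def coeff_map_poly coeff_pCons split: nat.splits)
    qed
    have "of_nat (m + 2) * homogenize (B (m + 2)) (m + 2) u v =
        homogenize (smult (of_nat (m + 2)) (B (m + 2))) (m + 2) u v"
      by (rule homogenize_smult[symmetric])
    also have "\<dots> = homogenize ([:1/2, 1/2:] * B (m + 1)) (Suc (m + 1)) u v
          - of_real (b / 2) * homogenize ([:-1, 1:] * ([:-1, 1:] * B m)) (Suc (Suc m)) u v"
      unfolding rec homogenize_diff homogenize_smult by (simp del: mult_pCons_left)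
    also have "\<dots> = (v / 2 + u / 2) * homogenize (B (m + 1)) (m + 1) u v
        - of_real (b / 2) * ((u - v) * ((u - v) * homogenize (B m) m u v))"
      unfolding homogenize_linear_mult[OF deg] homogenize_linear_mult[OF deg'] by simp
    also have "\<dots> = of_real (Re u * beam_form b (m + 1) (Re u) (Im u) + 2 * b * (Im u)\<^sup>2 * beam_form b m (Re u) (Im u))"
    proof -
      have "v / 2 + u / 2 = of_real (Re u)" by (simp add: v_def complex_eq_iff)
      moreover have "(u - v) * ((u - v) * w) = - 4 * of_real ((Im u)\<^sup>2) * w" for w
        by (simp add: v_def complex_eq_iff power2_eq_square algebra_simps)
      ultimately show ?thesis
        unfolding IH[symmetric] by simp
    qed
    also have "\<dots> = of_nat (m + 2) * of_real (beam_form b (m + 2) (Re u) (Im u))"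
      unfolding beam_form_Suc_Suc[symmetric] by simp
    finally have eq: "of_nat (m + 2) * homogenize (B (m + 2)) (m + 2) u v =
        of_nat (m + 2) * complex_of_real (beam_form b (m + 2) (Re u) (Im u))" .
    have nz: "(of_nat (m + 2) :: complex) \<noteq> 0"
      by (simp only: of_nat_eq_0_iff)
    have "homogenize (B (m + 2)) (m + 2) u v = complex_of_real (beam_form b (m + 2) (Re u) (Im u))"
      using eq mult_left_cancel[OF nz] by blast
    then show ?thesis by (simp only: 3 B_def v_def)
  qed
qed

lemma beam_form_sums: "(\<lambda>n. beam_form b n p q * \<tau> ^ n) sums exp (\<tau> * p + b * \<tau>\<^sup>2 * q\<^sup>2)"
proof -
  define A where "A i = (\<tau> * p) ^ i / fact i" for i
  define B where "B i = fps_nth (half_exp_fps (b * q\<^sup>2)) i * \<tau> ^ i" for i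
  have B: "B i = (if even i then (b * \<tau>\<^sup>2 * q\<^sup>2) ^ (i div 2) / fact (i div 2) else 0)" for i
    by (auto simp: B_def half_exp_fps_def power_mult_distrib power_mult[symmetric] elim!: evenE)
  have exp_sums: "(\<lambda>n. x ^ n / fact n) sums exp x" for x :: real
    using exp_converges[of x] by (simp add: field_simps)
  have even_sums: "(\<lambda>i. if even i then x ^ (i div 2) / fact (i div 2) else 0) sums exp x" for x :: real
    using sums_if[OF sums_zero exp_sums[of x]] by simp
  have 1: "A sums exp (\<tau> * p)" unfolding A_def[abs_def] by (rule exp_sums)
  have 2: "B sums exp (b * \<tau>\<^sup>2 * q\<^sup>2)" unfolding B by (rule even_sums)
  have 3: "summable (\<lambda>i. norm (A i))"
    using sums_summable[OF exp_sums[of "\<bar>\<tau> * p\<bar>"]] by (simp add: A_def power_abs)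
  have 4: "summable (\<lambda>i. norm (B i))"
  proof -
    have "(\<lambda>i. norm (B i)) = (\<lambda>i. if even i then \<bar>b * \<tau>\<^sup>2 * q\<^sup>2\<bar> ^ (i div 2) / fact (i div 2) else 0)"
      by (auto simp: B fun_eq_iff power_abs)
    then show ?thesis using sums_summable[OF even_sums] by simp
  qed
  have "beam_form b n p q * \<tau> ^ n = (\<Sum>i\<le>n. A i * B (n - i))" for n
    unfolding beam_form_def fps_mult_nth atLeast0AtMost sum_distrib_right
    by (intro sum.cong refl) (simp add: A_def B_def power_mult_distrib flip: power_add)
  then show ?thesis
    using Cauchy_product_sums[OF 3 4] sums_unique[OF 1] sums_unique[OF 2]
    by (simp add: exp_add)
qed

text \<open>
  A majorant on a ball, needed to integrate the power series term by term.
\<close>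

lemma abs_beam_form_le:
  assumes "b \<ge> 0" "\<bar>p\<bar> \<le> R" "\<bar>q\<bar> \<le> R"
  shows "\<bar>beam_form b n p q\<bar> \<le> beam_form b n R R"
proof -
  have R: "R \<ge> 0" using assms(2) by linarith
  have q: "q\<^sup>2 \<le> R\<^sup>2" using assms by (metis abs_le_square_iff abs_of_nonneg order_trans abs_ge_zero)
  have "\<bar>beam_form b n p q\<bar> \<le> (\<Sum>i=0..n. \<bar>fps_nth (fps_exp p) i * fps_nth (half_exp_fps (b * q\<^sup>2)) (n - i)\<bar>)"
    unfolding beam_form_def fps_mult_nth by (rule sum_abs)
  also have "\<dots> \<le> (\<Sum>i=0..n. fps_nth (fps_exp R) i * fps_nth (half_exp_fps (b * R\<^sup>2)) (n - i))"
  proof (rule sum_mono)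
    fix i
    have "\<bar>fps_nth (fps_exp p) i\<bar> \<le> fps_nth (fps_exp R) i"
      using assms by (simp add: power_abs divide_right_mono power_mono)
    moreover have "\<bar>fps_nth (half_exp_fps (b * q\<^sup>2)) (n - i)\<bar> \<le> fps_nth (half_exp_fps (b * R\<^sup>2)) (n - i)"
      using assms q by (auto simp: half_exp_fps_def power_abs abs_mult intro!: divide_right_mono power_mono mult_left_mono)
    ultimately show "\<bar>fps_nth (fps_exp p) i * fps_nth (half_exp_fps (b * q\<^sup>2)) (n - i)\<bar> \<le> fps_nth (fps_exp R) i * fps_nth (half_exp_fps (b * R\<^sup>2)) (n - i)"
      unfolding abs_mult using R by (intro mult_mono) auto
  qed
  finally show ?thesis by (simp add: beam_form_def fps_mult_nth)
qed

lemma powser_eq_0_imp_coeffs_eq_0: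
  fixes c :: "nat \<Rightarrow> 'a::{real_normed_field,banach}"
  assumes "\<And>x. (\<lambda>n. c n * x ^ n) sums 0"
  shows "c n = 0"
proof (cases "n = 0")
  case True
  then show ?thesis using assms[of 0] by (simp add: sums_unique2)
next
  case False
  show ?thesis
  proof (rule ccontr)
    assume "c n \<noteq> 0"
    \<comment> \<open>A nonzero coefficient would make the sum, which is zero, nonzero near the origin.\<close>
    obtain s where s: "0 < s" "\<And>z :: 'a. z \<in> cball 0 s - {0} \<Longrightarrow> (0::'a) \<noteq> 0"
      using powser_0_nonzero[of 1 0 c "\<lambda>_. 0" n] assms False \<open>c n \<noteq> 0\<close> by auto
    have "of_real s \<in> cball (0::'a) s - {0}" using s(1) by simp
    from s(2)[OF this] show False by simp
  qed
qed

section \<open>From vanishing data to relations between moments\<close>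

text \<open>
  For \<open>e = exp (- i \<theta>)\<close> the integral is a trigonometric polynomial in \<open>\<theta>\<close>, whose coefficients
  combine one moment of \<open>G\<close> with one of \<open>cnj G\<close>.  Multiplied by \<open>e ^ (n + 1)\<close> it becomes an
  ordinary polynomial in \<open>e\<^sup>2\<close> with infinitely many roots.
\<close>

lemma moment_relation:
  fixes r :: "complex poly"
  assumes G: "disk_function G"
    and zero: "\<And>\<theta>. \<theta> \<in> {0..<2 * pi} \<Longrightarrow>
      (LINT x|lborel. homogenize r n (complex_coord x * cis (- \<theta>)) (cnj (complex_coord x * cis (- \<theta>))) *
         (G x * cis (- \<theta>) - cnj (G x) * cis \<theta>)) = 0"
    and "a < n"
  shows "coeff r a * moment G a (n - a) = coeff r (Suc a) * moment (\<lambda>x. cnj (G x)) (Suc a) (n - Suc a)"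
proof -
  define A where "A a = moment G a (n - a)" for a
  define B where "B a = moment (\<lambda>x. cnj (G x)) a (n - a)" for a
  define Q where "Q = (\<Sum>a\<le>n. monom (coeff r a * A a) (Suc a) - monom (coeff r a * B a) a)"
  have G': "disk_function (\<lambda>x. cnj (G x))"
    using G by (auto simp: disk_function_def intro!: continuous_on_cnj)
  have int: "integrable lborel (\<lambda>x. complex_coord x ^ a * cnj (complex_coord x) ^ c * H x)"
    if "disk_function H" for H a c
    by (intro integrable_disk_function[OF that] continuous_on_mult continuous_on_power continuous_on_cnj
        continuous_on_complex_coord)
  have root: "poly Q (cis (- (2 * \<theta>))) = 0" if \<theta>: "\<theta> \<in> {0..<2 * pi}" for \<theta>
  proof -
    define e e' where "e = cis (- \<theta>)" and "e' = cis \<theta>"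
    have ee: "e * e' = 1" by (simp add: e_def e'_def cis_mult)
    have "homogenize r n (complex_coord x * e) (cnj (complex_coord x * e)) * (G x * e - cnj (G x) * e') =
       (\<Sum>a\<le>n. coeff r a * e ^ a * e' ^ (n - a) *
         (e * (complex_coord x ^ a * cnj (complex_coord x) ^ (n - a) * G x)
          - e' * (complex_coord x ^ a * cnj (complex_coord x) ^ (n - a) * cnj (G x))))" for x
      unfolding homogenize_def sum_distrib_right
      by (intro sum.cong refl) (simp add: e_def e'_def cis_cnj power_mult_distrib algebra_simps)
    then have "0 = (LINT x|lborel. (\<Sum>a\<le>n. coeff r a * e ^ a * e' ^ (n - a) *
         (e * (complex_coord x ^ a * cnj (complex_coord x) ^ (n - a) * G x)
          - e' * (complex_coord x ^ a * cnj (complex_coord x) ^ (n - a) * cnj (G x)))))"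
      using zero[OF \<theta>] by (simp add: e_def e'_def)
    also have "\<dots> = (\<Sum>a\<le>n. coeff r a * e ^ a * e' ^ (n - a) * (e * A a - e' * B a))"
      unfolding A_def B_def moment_def
      by (subst Bochner_Integration.integral_sum)
        (simp_all add: int G G' Bochner_Integration.integral_diff)
    finally have "0 = e ^ Suc n * (\<Sum>a\<le>n. coeff r a * e ^ a * e' ^ (n - a) * (e * A a - e' * B a))"
      by simp
    also have "\<dots> = (\<Sum>a\<le>n. coeff r a * A a * (e ^ 2) ^ Suc a - coeff r a * B a * (e ^ 2) ^ a)"
      unfolding sum_distrib_left
    proof (rule sum.cong[OF refl])
      fix a assume "a \<in> {..n}"
      then have "Suc n = Suc a + (n - a)" by simp
      then have "e ^ Suc n * e' ^ (n - a) = e ^ Suc a * (e * e') ^ (n - a)"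
        by (metis power_add power_mult_distrib mult.assoc)
      then have 1: "e ^ Suc n * e' ^ (n - a) = e ^ Suc a" by (simp add: ee)
      have "e ^ Suc n * (coeff r a * e ^ a * e' ^ (n - a) * (e * A a - e' * B a)) =
        (e ^ Suc n * e' ^ (n - a)) * (coeff r a * e ^ a * (e * A a - e' * B a))"
        by (simp only: mult_ac)
      also have "\<dots> = coeff r a * A a * (e ^ a * e ^ a * e * e) - coeff r a * B a * (e ^ a * e ^ a * (e * e'))"
        unfolding 1 by (simp add: algebra_simps)
      also have "\<dots> = coeff r a * A a * (e ^ 2) ^ Suc a - coeff r a * B a * (e ^ 2) ^ a"
        unfolding ee by (simp add: power2_eq_square power_mult_distrib mult_ac)
      finally show "e ^ Suc n * (coeff r a * e ^ a * e' ^ (n - a) * (e * A a - e' * B a)) =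
        coeff r a * A a * (e ^ 2) ^ Suc a - coeff r a * B a * (e ^ 2) ^ a" .
    qed
    also have "\<dots> = poly Q (e ^ 2)"
      by (simp add: Q_def poly_sum poly_monom)
    finally show ?thesis by (simp add: e_def power2_eq_square cis_mult)
  qed
  have "infinite ((\<lambda>\<theta>. cis (- (2 * \<theta>))) ` {0..1::real})"
  proof -
    have "inj_on (\<lambda>\<theta>. cis (- (2 * \<theta>))) {0..1::real}"
    proof (rule inj_onI)
      fix s t :: real assume st: "s \<in> {0..1}" "t \<in> {0..1}" and "cis (- (2 * s)) = cis (- (2 * t))"
      then have "cos (2 * s) = cos (2 * t)" by (simp add: cis.ctr)
      then show "s = t"
        using st pi_gt3 cos_inj_pi[of "2 * s" "2 * t"] by auto
    qed
    moreover have "infinite {0..1::real}" by simp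
    ultimately show ?thesis by (simp add: finite_image_iff)
  qed
  moreover have "(\<lambda>\<theta>. cis (- (2 * \<theta>))) ` {0..1::real} \<subseteq> {w. poly Q w = 0}"
    using root pi_gt3 by auto
  ultimately have "Q = 0"
    using poly_roots_finite finite_subset by blast
  then have "coeff Q (Suc a) = 0" by simp
  moreover have "coeff Q (Suc a) = coeff r a * A a - coeff r (Suc a) * B (Suc a)"
    using \<open>a < n\<close> by (simp add: Q_def coeff_sum sum_subtractf if_distrib[of "\<lambda>x. x = _"] cong: if_cong)
  ultimately show ?thesis by (simp add: A_def B_def)
qed

lemma dir_inner: "dir \<theta> \<bullet> x = Re (complex_coord x * cis (- \<theta>))"
  by (simp add: dir_def complex_coord_def inner_vec_def sum_2 cis.ctr)

lemma dir_perp_inner: "dir_perp \<theta> \<bullet> x = Im (complex_coord x * cis (- \<theta>))"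
  by (simp add: dir_perp_def complex_coord_def inner_vec_def sum_2 cis.ctr)

text \<open>
  The longitudinal component of the field, up to the constant \<open>2 * \<i>\<close>, in the form that
  \<open>moment_relation\<close> expects.
\<close>

lemma dir_perp_inner_complex:
  "complex_coord y * cis (- \<theta>) - cnj (complex_coord y) * cis \<theta> = 2 * \<i> * complex_of_real (dir_perp \<theta> \<bullet> y)"
  by (simp add: dir_perp_inner complex_eq_iff cis.ctr)

lemma abs_dir_inner_le: "\<bar>dir \<theta> \<bullet> x\<bar> \<le> norm x" "\<bar>dir_perp \<theta> \<bullet> x\<bar> \<le> norm x"
  using abs_Re_le_cmod[of "complex_coord x * cis (- \<theta>)"] abs_Im_le_cmod[of "complex_coord x * cis (- \<theta>)"]
  by (simp_all add: dir_inner dir_perp_inner norm_mult norm_complex_coord)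

text \<open>
  The vanishing integral is a power series in \<open>\<tau>\<close>, and the integrals in the conclusion are its
  coefficients.
\<close>

lemma integral_beam_form_eq_0:
  fixes \<phi> :: "real^2 \<Rightarrow> real"
  assumes \<phi>: "disk_function \<phi>" and "b \<ge> 0"
    and zero: "\<And>\<tau>. (LINT x|lborel. exp (\<tau> * (dir \<theta> \<bullet> x) + b * \<tau>\<^sup>2 * (dir_perp \<theta> \<bullet> x)\<^sup>2) * \<phi> x) = 0"
  shows "(LINT x|lborel. beam_form b n (dir \<theta> \<bullet> x) (dir_perp \<theta> \<bullet> x) * \<phi> x) = 0"
proof -
  define F where "F n x = beam_form b n (dir \<theta> \<bullet> x) (dir_perp \<theta> \<bullet> x)" for n x
  define c where "c n = (LINT x|lborel. F n x * \<phi> x)" for n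
  have cont: "continuous_on UNIV (F n)" for n
  proof -
    have "continuous_on UNIV (\<lambda>x. fps_nth (half_exp_fps (b * (dir_perp \<theta> \<bullet> x)\<^sup>2)) i)" for i
      by (cases "even i") (auto simp: half_exp_fps_def intro!: continuous_intros)
    then show ?thesis
      unfolding F_def[abs_def] beam_form_def fps_mult_nth by (auto intro!: continuous_intros)
  qed
  have int: "integrable lborel (\<lambda>x. F n x * \<phi> x)" for n
    by (intro integrable_disk_function \<phi> cont)
  have int_abs: "integrable lborel (\<lambda>x. \<bar>\<phi> x\<bar>)"
    using integrable_disk_function[OF \<phi>, of "\<lambda>_. 1"] by simp
  have "(\<lambda>n. c n * \<tau> ^ n) sums 0" for \<tau>
  proof -
    define M where "M n = beam_form b n 1 1 * \<bar>\<tau>\<bar> ^ n" for n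
    have M: "summable M"
      unfolding M_def[abs_def] by (rule sums_summable[OF beam_form_sums])
    have bound: "norm (F n x * \<phi> x * \<tau> ^ n) \<le> M n * \<bar>\<phi> x\<bar>" for n x
    proof (cases "norm x \<le> 1")
      case True
      have "\<bar>F n x\<bar> \<le> beam_form b n 1 1"
        unfolding F_def using abs_dir_inner_le[of \<theta> x] True assms(2)
        by (intro abs_beam_form_le) auto
      then have "\<bar>F n x\<bar> * (\<bar>\<phi> x\<bar> * \<bar>\<tau> ^ n\<bar>) \<le> beam_form b n 1 1 * (\<bar>\<phi> x\<bar> * \<bar>\<tau> ^ n\<bar>)"
        by (rule mult_right_mono) simp
      then show ?thesis by (simp add: M_def abs_mult power_abs mult_ac)
    next
      case False
      then show ?thesis using \<phi> by (simp add: disk_function_def)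
    qed
    have "(\<lambda>n. LINT x|lborel. F n x * \<phi> x * \<tau> ^ n) sums (LINT x|lborel. (\<Sum>n. F n x * \<phi> x * \<tau> ^ n))"
    proof (rule sums_integral)
      show "integrable lborel (\<lambda>x. F n x * \<phi> x * \<tau> ^ n)" for n
        by (intro integrable_mult_left int)
      show "AE x in lborel. summable (\<lambda>n. norm (F n x * \<phi> x * \<tau> ^ n))"
      proof (rule AE_I2)
        fix x
        show "summable (\<lambda>n. norm (F n x * \<phi> x * \<tau> ^ n))"
          by (rule summable_comparison_test_ev[OF _ summable_mult2[OF M, of "\<bar>\<phi> x\<bar>"]])
             (use bound in auto)
      qed
      show "summable (\<lambda>n. LINT x|lborel. norm (F n x * \<phi> x * \<tau> ^ n))"
      proof (rule summable_comparison_test_ev[OF _ summable_mult2[OF M, of "LINT x|lborel. \<bar>\<phi> x\<bar>"]])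
        have "(LINT x|lborel. norm (F n x * \<phi> x * \<tau> ^ n)) \<le> (LINT x|lborel. M n * \<bar>\<phi> x\<bar>)" for n
          by (intro integral_mono bound integrable_norm integrable_mult_left integrable_mult_right int int_abs)
        then show "\<forall>\<^sub>F n in sequentially. norm (LINT x|lborel. norm (F n x * \<phi> x * \<tau> ^ n))
            \<le> M n * (LINT x|lborel. \<bar>\<phi> x\<bar>)"
          by simp
      qed
    qed
    moreover have "(\<Sum>n. F n x * \<phi> x * \<tau> ^ n) =
        exp (\<tau> * (dir \<theta> \<bullet> x) + b * \<tau>\<^sup>2 * (dir_perp \<theta> \<bullet> x)\<^sup>2) * \<phi> x" for x
      using sums_unique[OF sums_mult2[OF beam_form_sums[of b "dir \<theta> \<bullet> x" "dir_perp \<theta> \<bullet> x" \<tau>], of "\<phi> x"]]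
      by (simp add: F_def mult_ac)
    ultimately show ?thesis by (simp add: zero c_def)
  qed
  then have "c n = 0" by (rule powser_eq_0_imp_coeffs_eq_0)
  then show ?thesis by (simp add: c_def F_def)
qed

section \<open>Vanishing exponential data force a vanishing field\<close>

lemma disk_function_complex_coord:
  assumes "disk_function g"
  shows "disk_function (\<lambda>x. complex_coord (g x))"
  using assms unfolding disk_function_def complex_coord_def
  by (auto intro!: continuous_intros simp: Complex_eq_0)

lemma disk_function_mult_left:
  fixes F \<phi> :: "real^2 \<Rightarrow> real"
  assumes "disk_function \<phi>" "continuous_on UNIV F"
  shows "disk_function (\<lambda>x. F x * \<phi> x)"
  using assms by (auto simp: disk_function_def intro!: continuous_intros)

lemma disk_function_inner:
  assumes "disk_function g"
  shows "disk_function (\<lambda>x. v \<bullet> g x)"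
  using assms by (auto simp: disk_function_def intro!: continuous_intros)

text \<open>
  The two data sets give two homogeneous linear equations for the same pair of moments; for \<open>k = 1\<close>
  the extra factor \<open>q = (u - v) / (2 i)\<close> multiplies the beam polynomial by \<open>u - v\<close>.
  Cramer's rule leaves only moments with vanishing determinant, finitely many on each diagonal.
\<close>

lemma field_eq_0_if_beam_data_eq_0:
  fixes g :: "real^2 \<Rightarrow> real^2"
  assumes g: "disk_function g" and b: "b > 0"
    and zero: "\<And>k \<theta> \<tau>. k \<in> {0, 1} \<Longrightarrow> \<theta> \<in> {0..<2 * pi} \<Longrightarrow>
       (LINT x|lborel. exp (\<tau> * (dir \<theta> \<bullet> x) + b * \<tau>\<^sup>2 * (dir_perp \<theta> \<bullet> x)\<^sup>2) *
          ((dir_perp \<theta> \<bullet> x) ^ k * (dir_perp \<theta> \<bullet> g x))) = 0"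
  shows "g = (\<lambda>_. 0)"
proof -
  define G where "G x = complex_coord (g x)" for x
  define \<beta> where "\<beta> = b / 4"
  define P where "P n = (map_poly of_real (beam_poly \<beta> n) :: complex poly)" for n
  have \<beta>: "\<beta> > 0" using b by (simp add: \<beta>_def)
  have G: "disk_function G"
    unfolding G_def by (rule disk_function_complex_coord[OF g])
  have form0: "(LINT x|lborel. beam_form b n (dir \<theta> \<bullet> x) (dir_perp \<theta> \<bullet> x) *
      ((dir_perp \<theta> \<bullet> x) ^ k * (dir_perp \<theta> \<bullet> g x))) = 0"
    if "k \<in> {0, 1}" "\<theta> \<in> {0..<2 * pi}" for n k \<theta>
    using zero[OF that] b
    by (intro integral_beam_form_eq_0 disk_function_mult_left disk_function_inner g continuous_intros) auto
  have hom: "homogenize (P n) n (complex_coord x * cis (- \<theta>)) (cnj (complex_coord x * cis (- \<theta>))) =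
      complex_of_real (beam_form b n (dir \<theta> \<bullet> x) (dir_perp \<theta> \<bullet> x))" for n x \<theta>
    unfolding P_def \<beta>_def dir_inner dir_perp_inner by (rule of_real_beam_form[symmetric])
  have degP: "degree (P n) \<le> n" for n
    using degree_beam_poly[of \<beta> n] by (simp add: P_def degree_map_poly)
  have rel1: "coeff (P n) a * moment G a (n - a) =
      coeff (P n) (Suc a) * moment (\<lambda>x. cnj (G x)) (Suc a) (n - Suc a)" if "a < n" for n a
  proof (rule moment_relation[OF G _ that])
    fix \<theta> :: real assume \<theta>: "\<theta> \<in> {0..<2 * pi}"
    have "(\<lambda>x. homogenize (P n) n (complex_coord x * cis (- \<theta>)) (cnj (complex_coord x * cis (- \<theta>))) *
         (G x * cis (- \<theta>) - cnj (G x) * cis \<theta>)) =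
       (\<lambda>x. 2 * \<i> * complex_of_real (beam_form b n (dir \<theta> \<bullet> x) (dir_perp \<theta> \<bullet> x) *
      ((dir_perp \<theta> \<bullet> x) ^ 0 * (dir_perp \<theta> \<bullet> g x))))"
      unfolding hom G_def dir_perp_inner_complex by (simp add: fun_eq_iff)
    then show "(LINT x|lborel. homogenize (P n) n (complex_coord x * cis (- \<theta>)) (cnj (complex_coord x * cis (- \<theta>))) *
         (G x * cis (- \<theta>) - cnj (G x) * cis \<theta>)) = 0"
      using form0[of 0 \<theta> n] \<theta> by (simp only: integral_mult_right_zero integral_complex_of_real) simp
  qed
  have rel2: "coeff ([:-1, 1:] * P n) a * moment G a (Suc n - a) =
      coeff ([:-1, 1:] * P n) (Suc a) * moment (\<lambda>x. cnj (G x)) (Suc a) (Suc n - Suc a)" if "a < Suc n" for n a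
  proof (rule moment_relation[OF G _ that])
    fix \<theta> :: real assume \<theta>: "\<theta> \<in> {0..<2 * pi}"
    have diff: "(-1) * cnj u + 1 * u = 2 * \<i> * complex_of_real (Im u)" for u
      by (simp add: complex_eq_iff)
    have "(\<lambda>x. homogenize ([:-1, 1:] * P n) (Suc n) (complex_coord x * cis (- \<theta>)) (cnj (complex_coord x * cis (- \<theta>))) *
         (G x * cis (- \<theta>) - cnj (G x) * cis \<theta>)) =
       (\<lambda>x. - 4 * complex_of_real (beam_form b n (dir \<theta> \<bullet> x) (dir_perp \<theta> \<bullet> x) *
      ((dir_perp \<theta> \<bullet> x) ^ 1 * (dir_perp \<theta> \<bullet> g x))))"
      unfolding homogenize_linear_mult[OF degP] hom G_def dir_perp_inner_complex diff dir_perp_inner[symmetric]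
      by (simp add: fun_eq_iff)
    then show "(LINT x|lborel. homogenize ([:-1, 1:] * P n) (Suc n) (complex_coord x * cis (- \<theta>)) (cnj (complex_coord x * cis (- \<theta>))) *
         (G x * cis (- \<theta>) - cnj (G x) * cis \<theta>)) = 0"
      using form0[of 1 \<theta> n] \<theta> by (simp only: integral_mult_right_zero integral_complex_of_real) simp
  qed
  have moment0: "moment G a c = 0" if ac: "a \<ge> 1" "c \<ge> 3" and det: "beam_det \<beta> a c \<noteq> 0" for a c
  proof -
    obtain a' c' where a': "a = Suc a'" and c': "c = c' + 3"
      using ac by (metis One_nat_def Suc_le_D le_add_diff_inverse2)
    define A B where "A = moment G a c" and "B = moment (\<lambda>x. cnj (G x)) (a + 1) (c - 1)"
    have cP: "coeff (P n) i = complex_of_real (coeff (beam_poly \<beta> n) i)" for n i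
      by (simp add: P_def coeff_map_poly)
    have 1: "complex_of_real (beam_coeff \<beta> a c) * A = complex_of_real (beam_coeff \<beta> (a + 1) (c - 1)) * B"
      using rel1[of a "a + c"] ac by (simp add: A_def B_def beam_coeff_def cP)
    have 2: "complex_of_real (beam_coeff \<beta> (a - 1) c - beam_coeff \<beta> a (c - 1)) * A =
        complex_of_real (beam_coeff \<beta> a (c - 1) - beam_coeff \<beta> (a + 1) (c - 2)) * B"
      using rel2[of a "a' + c"] ac
      by (simp add: A_def B_def beam_coeff_def cP a' c' add_ac eval_nat_numeral)
    have "complex_of_real (beam_det \<beta> a c) * A = 0"
    proof -
      have "complex_of_real (beam_det \<beta> a c) * A =
        complex_of_real (beam_coeff \<beta> a (c - 1) - beam_coeff \<beta> (a + 1) (c - 2)) * (complex_of_real (beam_coeff \<beta> a c) * A)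
        - complex_of_real (beam_coeff \<beta> (a + 1) (c - 1)) *
          (complex_of_real (beam_coeff \<beta> (a - 1) c - beam_coeff \<beta> a (c - 1)) * A)"
        unfolding beam_det_def by (simp add: algebra_simps)
      also have "\<dots> = 0" unfolding 1 2 by (simp add: algebra_simps)
      finally show ?thesis .
    qed
    then show ?thesis using det by (simp add: A_def)
  qed
  have "moment G a c = 0" for a c
  proof -
    define k where "k = max a c - min a c"
    obtain c0 where c0: "\<And>i. i \<ge> c0 \<Longrightarrow> beam_det \<beta> (i + k) i \<noteq> 0 \<and> beam_det \<beta> i (i + k) \<noteq> 0"
      using eventually_beam_det_nonzero[OF \<beta>] by blast
    show ?thesis
    proof (rule moment_eq_0_if_eventually[OF G])
      fix j assume j: "j \<ge> max c0 3"
      show "moment G (a + j) (c + j) = 0"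
      proof (rule moment0)
        show "beam_det \<beta> (a + j) (c + j) \<noteq> 0"
        proof (cases "a \<le> c")
          case True
          then have e: "c + j = (a + j) + k" by (simp add: k_def)
          have "a + j \<ge> c0" using j by simp
          from c0[OF this] show ?thesis unfolding e by blast
        next
          case False
          then have e: "a + j = (c + j) + k" by (simp add: k_def)
          have "c + j \<ge> c0" using j by simp
          from c0[OF this] show ?thesis unfolding e by blast
        qed
      qed (use j in auto)
    qed
  qed
  then have "G = (\<lambda>_. 0)"
    by (rule disk_function_eq_0_if_moments_eq_0[OF G])
  then have "complex_coord (g x) = 0" for x
    by (metis G_def)
  then show ?thesis
    by (auto simp: fun_eq_iff complex_coord_def complex_eq_iff vec_eq_iff forall_2)
qed

section \<open>The Laplace transform of the Gaussian beam\<close>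

lemma
  fixes p \<tau> w :: real
  assumes "w > 0"
  shows integrable_exp_gaussian: "integrable lborel (\<lambda>s. exp (\<tau> * s) * exp (- ((s - p)\<^sup>2 / w\<^sup>2)))"
    and integral_exp_gaussian:
      "(LINT s|lborel. exp (\<tau> * s) * exp (- ((s - p)\<^sup>2 / w\<^sup>2))) = w * sqrt pi * exp (\<tau> * p + \<tau>\<^sup>2 * w\<^sup>2 / 4)"
proof -
  define \<sigma> where "\<sigma> = w / sqrt 2"
  have \<sigma>: "2 * \<sigma>\<^sup>2 = w\<^sup>2" "\<sigma> > 0" using assms by (auto simp: \<sigma>_def power_divide)
  \<comment> \<open>the centre after completing the square\<close>
  define \<mu> where "\<mu> = p + \<tau> * w\<^sup>2 / 2"
  have eq: "(\<lambda>s. exp (\<tau> * s) * exp (- ((s - p)\<^sup>2 / w\<^sup>2))) =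
    (\<lambda>s. w * sqrt pi * exp (\<tau> * p + \<tau>\<^sup>2 * w\<^sup>2 / 4) * normal_density \<mu> \<sigma> s)"
  proof
    fix s
    have "\<tau> * s - (s - p)\<^sup>2 / w\<^sup>2 = (\<tau> * p + \<tau>\<^sup>2 * w\<^sup>2 / 4) - (s - \<mu>)\<^sup>2 / w\<^sup>2"
      using assms by (simp add: \<mu>_def field_simps power2_eq_square)
    then have "exp (\<tau> * s) * exp (- ((s - p)\<^sup>2 / w\<^sup>2)) =
        exp (\<tau> * p + \<tau>\<^sup>2 * w\<^sup>2 / 4) * exp (- (s - \<mu>)\<^sup>2 / w\<^sup>2)"
      by (simp flip: exp_add)
    moreover have "sqrt (2 * pi * \<sigma>\<^sup>2) = w * sqrt pi"
    proof -
      have "2 * pi * \<sigma>\<^sup>2 = w\<^sup>2 * pi" using \<sigma>(1) by (simp add: mult_ac)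
      then have "sqrt (2 * pi * \<sigma>\<^sup>2) = sqrt (w\<^sup>2 * pi)" by (rule arg_cong)
      also have "\<dots> = w * sqrt pi" using assms by (simp add: real_sqrt_mult)
      finally show ?thesis .
    qed
    ultimately show "exp (\<tau> * s) * exp (- ((s - p)\<^sup>2 / w\<^sup>2)) =
        w * sqrt pi * exp (\<tau> * p + \<tau>\<^sup>2 * w\<^sup>2 / 4) * normal_density \<mu> \<sigma> s"
      unfolding normal_density_def \<sigma>(1) using assms by simp
  qed
  show "integrable lborel (\<lambda>s. exp (\<tau> * s) * exp (- ((s - p)\<^sup>2 / w\<^sup>2)))"
    unfolding eq using \<sigma>(2) by (intro integrable_mult_right integrable_normal_density)
  show "(LINT s|lborel. exp (\<tau> * s) * exp (- ((s - p)\<^sup>2 / w\<^sup>2))) = w * sqrt pi * exp (\<tau> * p + \<tau>\<^sup>2 * w\<^sup>2 / 4)"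
    unfolding eq using \<sigma>(2) by simp
qed

lemma beam_width_pos: "w0 > 0 \<Longrightarrow> beam_width w0 lam u > 0"
  unfolding beam_width_def by (intro mult_pos_pos real_sqrt_gt_zero add_pos_nonneg) auto

lemma beam_width_sq: "(beam_width w0 lam u)\<^sup>2 = w0\<^sup>2 * (1 + (u / rayleigh_range w0 lam)\<^sup>2)"
  unfolding beam_width_def power_mult_distrib by (subst real_sqrt_pow2) auto

lemma continuous_on_beam_kernel:
  assumes "w0 > 0"
  shows "continuous_on UNIV (\<lambda>x. beam_kernel w0 lam (s - dir \<theta> \<bullet> x) (dir_perp \<theta> \<bullet> x))"
proof -
  have "continuous_on UNIV (\<lambda>x. beam_width w0 lam (dir_perp \<theta> \<bullet> x))"
    unfolding beam_width_def divide_inverse by (intro continuous_intros)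
  moreover have "beam_width w0 lam u \<noteq> 0" for u
    using beam_width_pos[OF assms, of lam u] by simp
  ultimately show ?thesis
    unfolding beam_kernel_def by (intro continuous_intros) auto
qed

text \<open>
  The normalization of the kernel cancels the width of the Gaussian, and the squared width in the
  exponent is affine in \<open>q\<^sup>2\<close>.  So the dependence on \<open>p\<close> and \<open>q\<close> is purely exponential.
\<close>

lemma
  assumes "w0 > 0"
  shows integrable_exp_beam_kernel: "integrable lborel (\<lambda>s. exp (\<tau> * s) * beam_kernel w0 lam (s - p) q)"
    and integral_exp_beam_kernel:
      "(LINT s|lborel. exp (\<tau> * s) * beam_kernel w0 lam (s - p) q) =
         w0 * sqrt pi * exp (\<tau>\<^sup>2 * w0\<^sup>2 / 4) * exp (\<tau> * p + w0\<^sup>2 / (4 * (rayleigh_range w0 lam)\<^sup>2) * \<tau>\<^sup>2 * q\<^sup>2)"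
proof -
  define w where "w = beam_width w0 lam q"
  have w: "w > 0" using beam_width_pos[OF assms] by (simp add: w_def)
  have eq: "(\<lambda>s. exp (\<tau> * s) * beam_kernel w0 lam (s - p) q) =
      (\<lambda>s. w0 / w * (exp (\<tau> * s) * exp (- ((s - p)\<^sup>2 / w\<^sup>2))))"
    by (simp add: beam_kernel_def w_def fun_eq_iff mult_ac)
  show "integrable lborel (\<lambda>s. exp (\<tau> * s) * beam_kernel w0 lam (s - p) q)"
    unfolding eq by (intro integrable_mult_right integrable_exp_gaussian w)
  have "(LINT s|lborel. exp (\<tau> * s) * beam_kernel w0 lam (s - p) q) =
      w0 / w * (w * sqrt pi * exp (\<tau> * p + \<tau>\<^sup>2 * w\<^sup>2 / 4))"
    unfolding eq integral_mult_right_zero integral_exp_gaussian[OF w] ..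
  also have "\<tau> * p + \<tau>\<^sup>2 * w\<^sup>2 / 4 =
      \<tau>\<^sup>2 * w0\<^sup>2 / 4 + (\<tau> * p + w0\<^sup>2 / (4 * (rayleigh_range w0 lam)\<^sup>2) * \<tau>\<^sup>2 * q\<^sup>2)"
    unfolding w_def beam_width_sq by (simp add: power_divide algebra_simps)
  finally show "(LINT s|lborel. exp (\<tau> * s) * beam_kernel w0 lam (s - p) q) =
         w0 * sqrt pi * exp (\<tau>\<^sup>2 * w0\<^sup>2 / 4) * exp (\<tau> * p + w0\<^sup>2 / (4 * (rayleigh_range w0 lam)\<^sup>2) * \<tau>\<^sup>2 * q\<^sup>2)"
    using w by (simp add: exp_add)
qed

text \<open>
  Fubini's theorem: the Laplace transform in \<open>s\<close> is taken inside the integral over the disk.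
\<close>

lemma beam_data_laplace:
  fixes \<phi> :: "real^2 \<Rightarrow> real"
  assumes "w0 > 0" and \<phi>: "disk_function \<phi>"
    and zero: "\<And>s. (LINT x|lborel. beam_kernel w0 lam (s - dir \<theta> \<bullet> x) (dir_perp \<theta> \<bullet> x) * \<phi> x) = 0"
  shows "(LINT x|lborel. exp (\<tau> * (dir \<theta> \<bullet> x) +
     w0\<^sup>2 / (4 * (rayleigh_range w0 lam)\<^sup>2) * \<tau>\<^sup>2 * (dir_perp \<theta> \<bullet> x)\<^sup>2) * \<phi> x) = 0"
proof -
  define E where "E x = exp (\<tau> * (dir \<theta> \<bullet> x) +
     w0\<^sup>2 / (4 * (rayleigh_range w0 lam)\<^sup>2) * \<tau>\<^sup>2 * (dir_perp \<theta> \<bullet> x)\<^sup>2)" for x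
  define C where "C = w0 * sqrt pi * exp (\<tau>\<^sup>2 * w0\<^sup>2 / 4)"
  define K where "K x s = exp (\<tau> * s) * beam_kernel w0 lam (s - dir \<theta> \<bullet> x) (dir_perp \<theta> \<bullet> x)" for x s
  have K_nonneg: "K x s \<ge> 0" for x s
    using assms(1) beam_width_pos[OF assms(1)] by (simp add: K_def beam_kernel_def less_imp_le)
  have K_int: "integrable lborel (K x)" "integral\<^sup>L lborel (K x) = C * E x" for x
    using integrable_exp_beam_kernel[OF assms(1)] integral_exp_beam_kernel[OF assms(1)]
    by (simp_all add: K_def[abs_def] C_def E_def)
  have contE: "continuous_on UNIV E"
    unfolding E_def[abs_def] by (intro continuous_intros)
  have [measurable]: "\<phi> \<in> borel_measurable borel"
    using \<phi> by (intro borel_measurable_continuous_onI) (simp add: disk_function_def)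
  have prod_int: "integrable (lborel \<Otimes>\<^sub>M lborel) (\<lambda>(x, s). K x s * \<phi> x)"
  proof (rule lborel_pair.Fubini_integrable)
    show "(\<lambda>(x, s). K x s * \<phi> x) \<in> borel_measurable (lborel \<Otimes>\<^sub>M lborel)"
      unfolding K_def beam_kernel_def beam_width_def by measurable
    have "(LINT s|lborel. norm (K x s * \<phi> x)) = C * (E x * \<bar>\<phi> x\<bar>)" for x
      using K_nonneg[of x] by (simp add: abs_mult K_int)
    moreover have "integrable lborel (\<lambda>x. norm (E x * \<phi> x))"
      by (intro integrable_norm integrable_disk_function \<phi> contE)
    then have "integrable lborel (\<lambda>x. C * (E x * \<bar>\<phi> x\<bar>))"
      by (intro integrable_mult_right) (simp add: abs_mult E_def)
    ultimately show "integrable lborel (\<lambda>x. LINT s|lborel. norm (case (x, s) of (x, s) \<Rightarrow> K x s * \<phi> x))"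
      by simp
    show "AE x in lborel. integrable lborel (\<lambda>s. case (x, s) of (x, s) \<Rightarrow> K x s * \<phi> x)"
      by (auto intro!: integrable_mult_left K_int)
  qed
  have "0 = (LINT s|lborel. LINT x|lborel. K x s * \<phi> x)"
    by (simp add: K_def mult.assoc zero)
  also have "\<dots> = (LINT x|lborel. LINT s|lborel. K x s * \<phi> x)"
    by (rule lborel_pair.Fubini_integral[OF prod_int])
  also have "\<dots> = C * (LINT x|lborel. E x * \<phi> x)"
    by (simp add: K_int mult.assoc)
  finally show ?thesis
    using assms(1) by (simp add: C_def E_def)
qed

section \<open>Uniqueness for the beam transforms\<close>

text \<open>
  Smoothness is given inside the disk only; continuity across the unit circle holds because the
  field is zero on the open complement of its support, which together with the disk covers the
  plane.
\<close>

lemma disk_function_test_field: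
  assumes "f \<in> test_fields unit_disk"
  shows "disk_function f"
proof -
  have comp: "continuous_on UNIV (\<lambda>x. f x $ i) \<and> (\<forall>x. norm x \<ge> 1 \<longrightarrow> f x $ i = 0)" for i
  proof -
    define S where "S = closure {x. f x $ i \<noteq> 0}"
    have "(\<lambda>x. f x $ i) \<in> test_functions unit_disk"
      using assms by (simp add: test_fields_def)
    then have S: "S \<subseteq> ball 0 1" and "Ck_on 0 (ball 0 1) (\<lambda>x. f x $ i)"
      by (auto simp: test_functions_def smooth_on_def unit_disk_def S_def)
    then have 1: "continuous_on (ball 0 1) (\<lambda>x. f x $ i)" by simp
    have out: "f x $ i = 0" if "x \<in> - S" for x
      using that closure_subset[of "{x. f x $ i \<noteq> 0}"] by (auto simp: S_def)
    have 2: "continuous_on (- S) (\<lambda>x. f x $ i)"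
      using out by (intro continuous_on_eq[OF continuous_on_const[of _ 0]]) simp
    have "continuous_on (ball 0 1 \<union> - S) (\<lambda>x. f x $ i)"
      by (rule continuous_on_open_Un[OF _ _ 1 2]) (auto simp: S_def)
    moreover have "ball 0 1 \<union> - S = UNIV" using S by blast
    moreover have "f x $ i = 0" if "norm x \<ge> 1" for x
      using S that by (intro out) force
    ultimately show ?thesis by simp
  qed
  have "continuous_on UNIV (\<lambda>x. \<chi> i. f x $ i)"
    using comp by (intro continuous_on_vec_lambda) simp
  then show ?thesis
    using comp by (auto simp: disk_function_def vec_eq_iff)
qed

text \<open>
  The earlier results apply to \<open>f - h\<close>, whose data vanish by linearity.
\<close>

lemma longitudinal_transform_unique:
  assumes "w0 > 0" "lam > 0" and f: "disk_function f" and h: "disk_function h"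
    and eq: "\<And>s \<theta> k. \<theta> \<in> {0..<2 * pi} \<Longrightarrow> k \<in> {0, 1} \<Longrightarrow>
      longitudinal_transform w0 lam k f s \<theta> = longitudinal_transform w0 lam k h s \<theta>"
  shows "f = h"
proof -
  define g where "g x = f x - h x" for x
  have g: "disk_function g"
    using f h by (auto simp: disk_function_def g_def[abs_def] intro!: continuous_intros)
  have "rayleigh_range w0 lam > 0" using assms by (simp add: rayleigh_range_def)
  then have b: "w0\<^sup>2 / (4 * (rayleigh_range w0 lam)\<^sup>2) > 0" using assms by simp
  have "g = (\<lambda>_. 0)"
  proof (rule field_eq_0_if_beam_data_eq_0[OF g b], rule beam_data_laplace[OF assms(1)])
    fix k :: nat and \<theta> :: real and \<tau> :: real assume k: "k \<in> {0, 1}" and \<theta>: "\<theta> \<in> {0..<2 * pi}"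
    have disk: "disk_function (\<lambda>x. (dir_perp \<theta> \<bullet> x) ^ k * (dir_perp \<theta> \<bullet> u x))" if "disk_function u" for u
      using that by (intro disk_function_mult_left disk_function_inner continuous_intros)
    show "disk_function (\<lambda>x. (dir_perp \<theta> \<bullet> x) ^ k * (dir_perp \<theta> \<bullet> g x))" by (rule disk[OF g])
    fix s
    let ?K = "\<lambda>x. beam_kernel w0 lam (s - dir \<theta> \<bullet> x) (dir_perp \<theta> \<bullet> x)"
    have L: "longitudinal_transform w0 lam k u s \<theta> =
        (LINT x|lborel. ?K x * ((dir_perp \<theta> \<bullet> x) ^ k * (dir_perp \<theta> \<bullet> u x)))" for u
      by (simp add: longitudinal_transform_def mult_ac)
    have int: "integrable lborel (\<lambda>x. ?K x * ((dir_perp \<theta> \<bullet> x) ^ k * (dir_perp \<theta> \<bullet> u x)))"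
      if "disk_function u" for u
      by (rule integrable_disk_function[OF disk[OF that] continuous_on_beam_kernel[OF assms(1)]])
    have "(LINT x|lborel. ?K x * ((dir_perp \<theta> \<bullet> x) ^ k * (dir_perp \<theta> \<bullet> g x))) =
       (LINT x|lborel. ?K x * ((dir_perp \<theta> \<bullet> x) ^ k * (dir_perp \<theta> \<bullet> f x))
          - ?K x * ((dir_perp \<theta> \<bullet> x) ^ k * (dir_perp \<theta> \<bullet> h x)))"
      by (simp add: g_def inner_diff_right algebra_simps)
    also have "\<dots> = longitudinal_transform w0 lam k f s \<theta> - longitudinal_transform w0 lam k h s \<theta>"
      unfolding L by (rule Bochner_Integration.integral_diff[OF int[OF f] int[OF h]])
    finally show "(LINT x|lborel. ?K x * ((dir_perp \<theta> \<bullet> x) ^ k * (dir_perp \<theta> \<bullet> g x))) = 0"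
      using eq[OF \<theta> k] by simp
  qed
  then show ?thesis by (simp add: fun_eq_iff g_def)
qed

definition quarter_turn :: "real^2 \<Rightarrow> real^2" where
  "quarter_turn v = vector [- (v $ 2), v $ 1]"

text \<open>
  The quarter turn maps \<open>dir \<theta>\<close> to \<open>dir_perp \<theta>\<close> and is an isometry.
\<close>

lemma transverse_transform_eq_longitudinal:
  "transverse_transform w0 lam k f s \<theta> = longitudinal_transform w0 lam k (\<lambda>x. quarter_turn (f x)) s \<theta>"
proof -
  have "dir \<theta> \<bullet> v = dir_perp \<theta> \<bullet> quarter_turn v" for v
    by (simp add: dir_def dir_perp_def quarter_turn_def inner_vec_def sum_2)
  then show ?thesis by (simp add: transverse_transform_def longitudinal_transform_def)
qed

lemma disk_function_quarter_turn:
  assumes "disk_function f"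
  shows "disk_function (\<lambda>x. quarter_turn (f x))"
proof -
  have turn: "quarter_turn v = (\<chi> i. if i = 1 then - (v $ 2) else v $ 1)" for v
    by (simp add: quarter_turn_def vec_eq_iff forall_2)
  have "continuous_on UNIV (\<lambda>x. \<chi> i::2. if i = 1 then - (f x $ 2) else f x $ 1)"
  proof (rule continuous_on_vec_lambda)
    fix i :: 2
    show "continuous_on UNIV (\<lambda>x. if i = 1 then - (f x $ 2) else f x $ 1)"
      using assms by (cases "i = 1") (auto simp: disk_function_def intro!: continuous_intros)
  qed
  then show ?thesis
    using assms by (simp add: disk_function_def turn vec_eq_iff)
qed

theorem theorem2:
  fixes w0 lam :: real and f h :: "real^2 \<Rightarrow> real^2"
  assumes "w0 > 0" and "lam > 0"
    and "f \<in> test_fields unit_disk" and "h \<in> test_fields unit_disk"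
  shows
    "((\<forall>s. \<forall>\<theta>\<in>{0..<2 * pi}.
         longitudinal_transform w0 lam 0 f s \<theta> = longitudinal_transform w0 lam 0 h s \<theta> \<and>
         longitudinal_transform w0 lam 1 f s \<theta> = longitudinal_transform w0 lam 1 h s \<theta>)
       \<longrightarrow> f = h) \<and>
     ((\<forall>s. \<forall>\<theta>\<in>{0..<2 * pi}.
         transverse_transform w0 lam 0 f s \<theta> = transverse_transform w0 lam 0 h s \<theta> \<and>
         transverse_transform w0 lam 1 f s \<theta> = transverse_transform w0 lam 1 h s \<theta>)
       \<longrightarrow> f = h)"
proof (intro conjI impI)
  note f = disk_function_test_field[OF assms(3)] and h = disk_function_test_field[OF assms(4)]
  show "f = h" if eq: "\<forall>s. \<forall>\<theta>\<in>{0..<2 * pi}.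
         longitudinal_transform w0 lam 0 f s \<theta> = longitudinal_transform w0 lam 0 h s \<theta> \<and>
         longitudinal_transform w0 lam 1 f s \<theta> = longitudinal_transform w0 lam 1 h s \<theta>"
    using eq by (intro longitudinal_transform_unique[OF assms(1,2) f h]) auto
  show "f = h" if eq: "\<forall>s. \<forall>\<theta>\<in>{0..<2 * pi}.
         transverse_transform w0 lam 0 f s \<theta> = transverse_transform w0 lam 0 h s \<theta> \<and>
         transverse_transform w0 lam 1 f s \<theta> = transverse_transform w0 lam 1 h s \<theta>"
  proof -
    have "(\<lambda>x. quarter_turn (f x)) = (\<lambda>x. quarter_turn (h x))"
      using eq unfolding transverse_transform_eq_longitudinal
      by (intro longitudinal_transform_unique[OF assms(1,2)] disk_function_quarter_turn f h) auto
    then have "quarter_turn (f x) = quarter_turn (h x)" for x by (rule fun_cong)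
    then show ?thesis
      by (auto simp: fun_eq_iff quarter_turn_def vec_eq_iff forall_2)
  qed
qed

end
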